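(* Let $n,m,l\in\mathbb{N}$ and let $F:\mathbb{P}_n\times\mathbb{P}_m\to\mathbb{P}_l$ be a function. Consider the conditions: (a) $(A,B)\mapsto\|F(A,B)\|_!$ is jointly concave for every symmetric anti-norm $\|\cdot\|_!$ on $\mathbb{M}_l^+$; (a)$'$ $(A,B)\mapsto\|F(A,B)\|_{\{k\}}$ is jointly concave for every Ky Fan $k$-anti-norm, $1\le k\le l$; (b) $(A,B)\mapsto\|F(A,B)^{-1}\|$ is jointly convex for every symmetric norm $\|\cdot\|$ on $\mathbb{M}_l$; (b)$'$ $(A,B)\mapsto\|F(A,B)^{-1}\|_{(k)}$ is jointly convex for every Ky Fan $k$-norm, $1\le k\le l$; (c) $(A,B)\mapsto\mathrm{Tr}\, f(F(A,B))$ is jointly concave for every non-decreasing concave function $f$ on $(0,\infty)$; (d) $(A,B)\mapsto\mathrm{Tr}\, f(F(A,B)^{-1})$ is jointly convex for every non-decreasing convex function $f$ on $(0,\infty)$. Then (a) $\Leftrightarrow$ (a)$'$ $\Rightarrow$ (b) $\Leftrightarrow$ (b)$'$ $\Rightarrow$ (d), and (a) $\Rightarrow$ (c) $\Rightarrow$ (d).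
   Context: $\mathbb{M}_l$: $l\times l$ complex matrices; $\mathbb{M}_l^+$: positive semidefinite ones; $\mathbb{P}_l$: positive definite ones. A symmetric norm on $\mathbb{M}_l$ is a norm with $\|UXV\|=\|X\|$ for all unitaries $U,V$. A symmetric anti-norm $\|\cdot\|_!$ on $\mathbb{M}_l^+$ is a non-negative continuous functional with $\|\lambda A\|_!=\lambda\|A\|_!$, $\|UAU^*\|_!=\|A\|_!$, $\|A+B\|_!\ge\|A\|_!+\|B\|_!$ for all $A,B\in\mathbb{M}_l^+$, $\lambda\ge0$, unitaries $U$. With $\lambda_1(A)\ge\dots\ge\lambda_l(A)$ the eigenvalues of $A\in\mathbb{M}_l^+$ with multiplicities, the Ky Fan $k$-norm is $\|A\|_{(k)}=\sum_{j=1}^k\lambda_j(A)$ and the Ky Fan $k$-anti-norm is $\|A\|_{\{k\}}=\sum_{j=1}^k\lambda_{l+1-j}(A)$. *)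

theory Defs
  imports "Jordan_Normal_Form.Schur_Decomposition" "Jordan_Normal_Form.Char_Poly"
    "HOL-Analysis.Convex"
begin

definition hermitian_mat :: "nat \<Rightarrow> complex mat \<Rightarrow> bool" where
  "hermitian_mat l A \<longleftrightarrow> A \<in> carrier_mat l l \<and> mat_adjoint A = A"

definition psd_mat :: "nat \<Rightarrow> complex mat \<Rightarrow> bool" where
  "psd_mat l A \<longleftrightarrow> hermitian_mat l A \<and>
     (\<forall>v \<in> carrier_vec l. 0 \<le> Re (conjugate v \<bullet> (A *\<^sub>v v)))"

definition pd_mat :: "nat \<Rightarrow> complex mat \<Rightarrow> bool" where
  "pd_mat l A \<longleftrightarrow> hermitian_mat l A \<and>
     (\<forall>v \<in> carrier_vec l. v \<noteq> 0\<^sub>v l \<longrightarrow> 0 < Re (conjugate v \<bullet> (A *\<^sub>v v)))"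

definition unitary_mat :: "nat \<Rightarrow> complex mat \<Rightarrow> bool" where
  "unitary_mat l U \<longleftrightarrow> U \<in> carrier_mat l l \<and> U * mat_adjoint U = 1\<^sub>m l
      \<and> mat_adjoint U * U = 1\<^sub>m l"

definition mat_inv :: "nat \<Rightarrow> complex mat \<Rightarrow> complex mat" where
  "mat_inv l A = (SOME B. B \<in> carrier_mat l l \<and> A * B = 1\<^sub>m l \<and> B * A = 1\<^sub>m l)"

text \<open>Eigenvalues with multiplicities (roots of the characteristic polynomial),
  real parts, listed in non-increasing order: eigs A ! (j-1) = lambda_j(A).
  For Hermitian matrices all eigenvalues are real.\<close>
definition eigs :: "complex mat \<Rightarrow> real list" where
  "eigs A = rev (sorted_list_of_multiset (image_mset Re (proots (char_poly A))))"

definition ky_fan_norm :: "nat \<Rightarrow> complex mat \<Rightarrow> real" where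
  "ky_fan_norm k A = sum_list (take k (eigs A))"

definition ky_fan_antinorm :: "nat \<Rightarrow> complex mat \<Rightarrow> real" where
  "ky_fan_antinorm k A = sum_list (take k (rev (eigs A)))"

text \<open>Tr f(A) for Hermitian A, computed through the spectral decomposition:
  sum of f over the eigenvalues (with multiplicities).\<close>
definition tr_fun :: "(real \<Rightarrow> real) \<Rightarrow> complex mat \<Rightarrow> real" where
  "tr_fun f A = sum_list (map f (eigs A))"

definition symmetric_norm :: "nat \<Rightarrow> (complex mat \<Rightarrow> real) \<Rightarrow> bool" where
  "symmetric_norm l N \<longleftrightarrow>
     (\<forall>X \<in> carrier_mat l l. 0 \<le> N X) \<and>
     (\<forall>X \<in> carrier_mat l l. N X = 0 \<longrightarrow> X = 0\<^sub>m l l) \<and>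
     (\<forall>X \<in> carrier_mat l l. \<forall>c. N (c \<cdot>\<^sub>m X) = cmod c * N X) \<and>
     (\<forall>X \<in> carrier_mat l l. \<forall>Y \<in> carrier_mat l l. N (X + Y) \<le> N X + N Y) \<and>
     (\<forall>X \<in> carrier_mat l l. \<forall>U V. unitary_mat l U \<longrightarrow> unitary_mat l V \<longrightarrow>
        N (U * X * V) = N X)"

definition mat_tendsto :: "nat \<Rightarrow> (nat \<Rightarrow> complex mat) \<Rightarrow> complex mat \<Rightarrow> bool" where
  "mat_tendsto l Xs X \<longleftrightarrow> (\<forall>i<l. \<forall>j<l. (\<lambda>k. Xs k $$ (i,j)) \<longlonglongrightarrow> X $$ (i,j))"

definition symmetric_antinorm :: "nat \<Rightarrow> (complex mat \<Rightarrow> real) \<Rightarrow> bool" where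
  "symmetric_antinorm l N \<longleftrightarrow>
     (\<forall>A. psd_mat l A \<longrightarrow> 0 \<le> N A) \<and>
     (\<forall>As A. (\<forall>k. psd_mat l (As k)) \<longrightarrow> psd_mat l A \<longrightarrow> mat_tendsto l As A \<longrightarrow>
        (\<lambda>k. N (As k)) \<longlonglongrightarrow> N A) \<and>
     (\<forall>A (t::real). psd_mat l A \<longrightarrow> 0 \<le> t \<longrightarrow> N (complex_of_real t \<cdot>\<^sub>m A) = t * N A) \<and>
     (\<forall>A U. psd_mat l A \<longrightarrow> unitary_mat l U \<longrightarrow> N (U * A * mat_adjoint U) = N A) \<and>
     (\<forall>A B. psd_mat l A \<longrightarrow> psd_mat l B \<longrightarrow> N A + N B \<le> N (A + B))"

definition jointly_concave :: "nat \<Rightarrow> nat \<Rightarrow> (complex mat \<Rightarrow> complex mat \<Rightarrow> real) \<Rightarrow> bool" where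
  "jointly_concave n m g \<longleftrightarrow>
     (\<forall>A1 A2 B1 B2 (t::real). pd_mat n A1 \<longrightarrow> pd_mat n A2 \<longrightarrow> pd_mat m B1 \<longrightarrow> pd_mat m B2 \<longrightarrow>
        0 \<le> t \<longrightarrow> t \<le> 1 \<longrightarrow>
        t * g A1 B1 + (1 - t) * g A2 B2 \<le>
        g (complex_of_real t \<cdot>\<^sub>m A1 + complex_of_real (1 - t) \<cdot>\<^sub>m A2)
          (complex_of_real t \<cdot>\<^sub>m B1 + complex_of_real (1 - t) \<cdot>\<^sub>m B2))"

definition jointly_convex :: "nat \<Rightarrow> nat \<Rightarrow> (complex mat \<Rightarrow> complex mat \<Rightarrow> real) \<Rightarrow> bool" where
  "jointly_convex n m g \<longleftrightarrow>
     (\<forall>A1 A2 B1 B2 (t::real). pd_mat n A1 \<longrightarrow> pd_mat n A2 \<longrightarrow> pd_mat m B1 \<longrightarrow> pd_mat m B2 \<longrightarrow>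
        0 \<le> t \<longrightarrow> t \<le> 1 \<longrightarrow>
        g (complex_of_real t \<cdot>\<^sub>m A1 + complex_of_real (1 - t) \<cdot>\<^sub>m A2)
          (complex_of_real t \<cdot>\<^sub>m B1 + complex_of_real (1 - t) \<cdot>\<^sub>m B2)
        \<le> t * g A1 B1 + (1 - t) * g A2 B2)"

end

theory Submission
  imports Defs "HOL-Combinatorics.Permutations"
begin

text \<open>
  Fix a convex combination of two arguments and let \<open>x\<close>, \<open>y\<close>, \<open>z\<close> be the increasingly ordered
  spectra of \<open>F\<close> there and at the two end points. Condition (a)' says that the partial sums of
  \<open>x\<close> dominate those of \<open>w = t y + (1 - t) z\<close>. Then \<open>x\<close> dominates a vector obtained from \<open>w\<close> by
  averagings of pairs of entries, and a superadditive, unitarily invariant functional can only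
  increase under both operations; this gives (a). Abel summation against the decreasing
  supergradients at \<open>x\<close> gives (c), and, with the concave function \<open>- 1 / s\<close>, that the partial sums
  of \<open>1 / x\<close> are dominated by those of \<open>1 / w\<close>, hence by those of \<open>t / y + (1 - t) / z\<close>: this is
  (b)'. From (b)' the conditions (b) and (d) follow in the same way, norms being convex and
  invariant under sign changes of diagonal entries. Conversely (a) and (b) specialize to (a)' and
  (b)' because the Ky Fan functionals have variational formulas over unitaries. Finally (c) implies
  (d) since \<open>- f (1 / s)\<close> is non-decreasing and concave when \<open>f\<close> is non-decreasing and convex.
\<close>

section \<open>Weak majorization of real sequences\<close>

text \<open>Once (a)' is read as an inequality of partial sums, the forward implications compare
  three fixed real sequences; matrices that do not commute enter only in the converses (a) to (a)'
  and (b) to (b)'. The two families of partial sums fit together because inversion reverses the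
  order: the reciprocals of the \<open>k\<close> smallest eigenvalues of \<open>F\<close> are, index
  by index, the \<open>k\<close> largest eigenvalues of its inverse. Abel summation works for every
  prefix length, so comparing the first \<open>k\<close> entries alone gives the inequality for the
  Ky Fan norm of order \<open>k\<close>. The two converses differ in kind. An anti-norm lives on
  positive semidefinite matrices, so the Ky Fan anti-norm is itself an admissible functional. A norm
  is required on all matrices, so the Ky Fan norm, given here through eigenvalues, has to be
  extended before (b) can be applied to it. Since the totals of \<open>x\<close> and
  \<open>w\<close> may differ, averaging alone cannot reach \<open>x\<close>. The chain stops at a
  vector lying on one side of \<open>x\<close> in every entry, and monotonicity of the functional
  bridges the rest.\<close>

lemma abel_sum_nonneg:
  fixes s d :: "nat \<Rightarrow> real"
  assumes anti: "\<And>i j. i \<le> j \<Longrightarrow> j < n \<Longrightarrow> s j \<le> s i"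
    and nonneg: "\<And>i. i < n \<Longrightarrow> 0 \<le> s i"
    and partial: "\<And>k. k \<le> n \<Longrightarrow> 0 \<le> (\<Sum>i<k. d i)"
  shows "0 \<le> (\<Sum>i<n. s i * d i)"
proof -
  \<comment> \<open>Summation by parts as an induction: lowering the weight from \<open>s k\<close>
    to \<open>s (Suc k)\<close> can only decrease the left side, because the prefix sum of
    \<open>d\<close> that it multiplies is nonnegative.\<close>
  have *: "s k * (\<Sum>i<Suc k. d i) \<le> (\<Sum>i<Suc k. s i * d i)" if "k < n" for k
    using that
  proof (induction k)
    case (Suc k)
    have "s (Suc k) * (\<Sum>i<Suc k. d i) \<le> s k * (\<Sum>i<Suc k. d i)"
      by (rule mult_right_mono) (use Suc.prems anti[of k "Suc k"] partial[of "Suc k"] in auto)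
    also have "\<dots> \<le> (\<Sum>i<Suc k. s i * d i)"
      using Suc by simp
    finally show ?case
      by (simp add: algebra_simps)
  qed simp
  show ?thesis
  proof (cases n)
    case (Suc k)
    have "0 \<le> s k * (\<Sum>i<Suc k. d i)"
      using Suc nonneg[of k] partial[of n] by (intro mult_nonneg_nonneg) auto
    with *[of k] Suc show ?thesis by simp
  qed simp
qed

section \<open>Fractional selections of k entries\<close>

lemma sum_indicator_lessThan:
  fixes f :: "nat \<Rightarrow> real"
  shows "(\<Sum>i<n. f i * (if i < k then 1 else 0)) = (\<Sum>i<min n k. f i)"
proof -
  have "(\<Sum>i<n. f i * (if i < k then 1 else 0)) = (\<Sum>i\<in>{..<n} \<inter> {..<k}. f i)"
    by (subst sum.inter_restrict) (auto intro!: sum.cong)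
  also have "{..<n} \<inter> {..<k} = {..<min n k}" by auto
  finally show ?thesis .
qed

text \<open>The first \<open>j\<close> weights total at most \<open>j\<close>, each being at most 1,
  and at most \<open>k\<close>. The greedy selection of the first \<open>k\<close> indices attains
  the smaller of these two bounds at every \<open>j\<close>, so its prefix sums are the largest
  possible. This is the input that Abel summation asks for.\<close>

lemma fractional_selection_partial:
  fixes c :: "nat \<Rightarrow> real"
  assumes c: "\<And>i. i < n \<Longrightarrow> 0 \<le> c i" "\<And>i. i < n \<Longrightarrow> c i \<le> 1"
    and sum: "(\<Sum>i<n. c i) \<le> real k" and j: "j \<le> n"
  shows "0 \<le> (\<Sum>i<j. (if i < k then 1 else 0) - c i)"
proof -
  have "(\<Sum>i<j. c i) \<le> (\<Sum>i<j. 1)"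
    using c j by (intro sum_mono) auto
  moreover have "(\<Sum>i<j. c i) \<le> (\<Sum>i<n. c i)"
    using c j by (intro sum_mono2) auto
  moreover have "(\<Sum>i<j. if i < k then 1 else 0) = real (min j k)"
    using sum_indicator_lessThan[of "\<lambda>_. 1" k j] by simp
  ultimately show ?thesis
    using sum by (simp add: sum_subtractf min_def)
qed

lemma fractional_selection_le:
  fixes c d :: "nat \<Rightarrow> real"
  assumes d: "\<And>i j. i \<le> j \<Longrightarrow> j < n \<Longrightarrow> d j \<le> d i" "\<And>i. i < n \<Longrightarrow> 0 \<le> d i"
    and c: "\<And>i. i < n \<Longrightarrow> 0 \<le> c i" "\<And>i. i < n \<Longrightarrow> c i \<le> 1"
    and sum: "(\<Sum>i<n. c i) \<le> real k" and k: "k \<le> n"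
  shows "(\<Sum>i<n. c i * d i) \<le> (\<Sum>i<k. d i)"
proof -
  have "0 \<le> (\<Sum>i<n. d i * ((if i < k then 1 else 0) - c i))"
    using fractional_selection_partial[OF c sum] by (intro abel_sum_nonneg d) auto
  then show ?thesis
    using k by (simp add: right_diff_distrib sum_subtractf sum_indicator_lessThan min_absorb2 mult.commute)
qed

lemma fractional_selection_ge:
  fixes c d :: "nat \<Rightarrow> real"
  assumes d: "\<And>i j. i \<le> j \<Longrightarrow> j < n \<Longrightarrow> d i \<le> d j"
    and c: "\<And>i. i < n \<Longrightarrow> 0 \<le> c i" "\<And>i. i < n \<Longrightarrow> c i \<le> 1"
    and sum: "(\<Sum>i<n. c i) = real k" and k: "k \<le> n"
  shows "(\<Sum>i<k. d i) \<le> (\<Sum>i<n. c i * d i)"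
proof -
  \<comment> \<open>Subtracting from the largest entry makes the coefficients nonnegative and
    decreasing. The shift drops out at the end because the weights total exactly \<open>k\<close>,
    which is why equality is assumed here and only an upper bound in the previous lemma.\<close>
  define M where "M = d (n - 1)"
  have "0 \<le> (\<Sum>i<n. (M - d i) * ((if i < k then 1 else 0) - c i))"
    using fractional_selection_partial[OF c eq_refl[OF sum]] d
    by (intro abel_sum_nonneg) (auto simp: M_def)
  also have "\<dots> = M * (\<Sum>i<n. 1 * (if i < k then 1 else 0)) - M * (\<Sum>i<n. c i)
      - ((\<Sum>i<n. d i * (if i < k then 1 else 0)) - (\<Sum>i<n. c i * d i))"
    by (simp add: sum_distrib_left sum_subtractf[symmetric] algebra_simps)
  finally show ?thesis
    using k unfolding sum_indicator_lessThan sum by (simp add: min_absorb2)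
qed

section \<open>Supporting lines on the positive half-line\<close>

lemma convex_on_subgradient_exists:
  fixes f :: "real \<Rightarrow> real"
  assumes conv: "convex_on {0<..} f" and x: "0 < x"
  shows "\<exists>s. \<forall>y>0. f x + s * (y - x) \<le> f y"
proof -
  \<comment> \<open>\<open>R\<close> collects the slopes of secants from \<open>x\<close> to the
    right; its infimum is the right derivative. Every slope to the left of \<open>x\<close> is a
    lower bound of \<open>R\<close>, so this one number supports \<open>f\<close> on both sides. The
    point \<open>x / 2\<close> below is a left neighbour that stays in the domain.\<close>
  define R where "R = (\<lambda>y. (f x - f y) / (x - y)) ` {x<..}"
  have lower: "(f y - f x) / (y - x) \<le> r" if "0 < y" "y < x" "r \<in> R" for y r
    using convex_on_slope_le[OF conv, of y _ x] that x unfolding R_def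
    by (force intro: order_trans)
  have ne: "R \<noteq> {}" by (simp add: R_def)
  have bdd: "bdd_below R" using lower[of "x / 2"] x by (intro bdd_belowI) auto
  have "f x + Inf R * (y - x) \<le> f y" if y: "0 < y" for y
  proof (cases x y rule: linorder_cases)
    case less
    then have "Inf R \<le> (f x - f y) / (x - y)"
      using bdd by (intro cInf_lower) (auto simp: R_def)
    with less show ?thesis by (simp add: field_simps)
  next
    case greater
    have "(f y - f x) / (y - x) \<le> Inf R"
      using lower[OF y greater] by (intro cInf_greatest ne) auto
    with greater show ?thesis by (simp add: field_simps)
  qed simp
  then show ?thesis by blast
qed

lemma convex_mono_subgradient:
  fixes f :: "real \<Rightarrow> real"
  assumes conv: "convex_on {0<..} f" and mono: "mono_on {0<..} f"
  obtains s where "\<And>x y. 0 < x \<Longrightarrow> 0 < y \<Longrightarrow> f x + s x * (y - x) \<le> f y"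
    and "\<And>x. 0 < x \<Longrightarrow> 0 \<le> s x" and "\<And>x y. 0 < x \<Longrightarrow> x \<le> y \<Longrightarrow> s x \<le> s y"
proof -
  obtain s where sub: "f x + s x * (y - x) \<le> f y" if "0 < x" "0 < y" for x y
    using convex_on_subgradient_exists[OF conv] by metis
  have nonneg: "0 \<le> s x" if "0 < x" for x
  proof -
    have "s x * (x / 2 - x) \<le> f (x / 2) - f x"
      using sub[of x "x / 2"] that by simp
    also have "\<dots> \<le> 0"
      using mono_onD[OF mono, of "x / 2" x] that by simp
    finally have "0 \<le> s x * x" by simp
    with that show ?thesis by (simp add: zero_le_mult_iff)
  qed
  \<comment> \<open>Adding the supporting inequalities at \<open>x\<close> and at \<open>y\<close>
    cancels the values of \<open>f\<close>, so any choice of subgradients is monotone.\<close>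
  have "s x \<le> s y" if "0 < x" "x \<le> y" for x y
  proof (cases "x = y")
    case False
    have "s x * (y - x) \<le> s y * (y - x)"
      using sub[of x y] sub[of y x] that by (simp add: algebra_simps)
    with False that show ?thesis by simp
  qed simp
  with sub nonneg show ?thesis by (rule that)
qed

lemma concave_mono_supergradient:
  fixes f :: "real \<Rightarrow> real"
  assumes conc: "concave_on {0<..} f" and mono: "mono_on {0<..} f"
  obtains s where "\<And>x y. 0 < x \<Longrightarrow> 0 < y \<Longrightarrow> f y \<le> f x + s x * (y - x)"
    and "\<And>x. 0 < x \<Longrightarrow> 0 \<le> s x" and "\<And>x y. 0 < x \<Longrightarrow> x \<le> y \<Longrightarrow> s y \<le> s x"
proof -
  have conv: "convex_on {0<..} (\<lambda>x. - f x)"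
    using conc by (simp add: concave_on_def)
  obtain s' where "- f x + s' x * (y - x) \<le> - f y" if "0 < x" "0 < y" for x y
    using convex_on_subgradient_exists[OF conv] by metis
  moreover define s where "s x = - s' x" for x
  ultimately have sup: "f y \<le> f x + s x * (y - x)" if "0 < x" "0 < y" for x y
    using that by (fastforce simp: algebra_simps)
  have nonneg: "0 \<le> s x" if "0 < x" for x
    using sup[of x "x + 1"] mono_onD[OF mono, of x "x + 1"] that by simp
  have "s y \<le> s x" if "0 < x" "x \<le> y" for x y
  proof (cases "x = y")
    case False
    have "s y * (y - x) \<le> s x * (y - x)"
      using sup[of x y] sup[of y x] that by (simp add: algebra_simps)
    with False that show ?thesis by simp
  qed simp
  with sup nonneg show ?thesis by (rule that)
qed

lemma weak_submajorization_sum_convex: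
  fixes x w :: "nat \<Rightarrow> real"
  assumes f: "convex_on {0<..} f" "mono_on {0<..} f"
    and x: "\<And>i j. i \<le> j \<Longrightarrow> j < n \<Longrightarrow> x j \<le> x i"
    and pos: "\<And>i. i < n \<Longrightarrow> 0 < x i" "\<And>i. i < n \<Longrightarrow> 0 < w i"
    and maj: "\<And>k. k \<le> n \<Longrightarrow> (\<Sum>i<k. x i) \<le> (\<Sum>i<k. w i)"
  shows "(\<Sum>i<n. f (x i)) \<le> (\<Sum>i<n. f (w i))"
proof -
  obtain s where s: "\<And>x y. 0 < x \<Longrightarrow> 0 < y \<Longrightarrow> f x + s x * (y - x) \<le> f y"
    "\<And>x. 0 < x \<Longrightarrow> 0 \<le> s x" "\<And>x y. 0 < x \<Longrightarrow> x \<le> y \<Longrightarrow> s x \<le> s y"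
    using convex_mono_subgradient[OF f] by metis
  \<comment> \<open>The slopes are taken at \<open>x\<close> only: along the decreasing sequence
    \<open>x\<close> they decrease as well, which makes them valid weights for Abel
    summation.\<close>
  have "0 \<le> (\<Sum>i<n. s (x i) * (w i - x i))"
    using maj by (intro abel_sum_nonneg) (auto simp: s pos x sum_subtractf)
  also have "\<dots> \<le> (\<Sum>i<n. f (w i) - f (x i))"
    using s(1)[OF pos] by (intro sum_mono) (simp add: add.commute le_diff_eq)
  finally show ?thesis by (simp add: sum_subtractf)
qed

lemma weak_supermajorization_sum_concave:
  fixes x w :: "nat \<Rightarrow> real"
  assumes f: "concave_on {0<..} f" "mono_on {0<..} f"
    and x: "\<And>i j. i \<le> j \<Longrightarrow> j < n \<Longrightarrow> x i \<le> x j"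
    and pos: "\<And>i. i < n \<Longrightarrow> 0 < x i" "\<And>i. i < n \<Longrightarrow> 0 < w i"
    and maj: "\<And>k. k \<le> n \<Longrightarrow> (\<Sum>i<k. w i) \<le> (\<Sum>i<k. x i)"
  shows "(\<Sum>i<n. f (w i)) \<le> (\<Sum>i<n. f (x i))"
proof -
  obtain s where s: "\<And>x y. 0 < x \<Longrightarrow> 0 < y \<Longrightarrow> f y \<le> f x + s x * (y - x)"
    "\<And>x. 0 < x \<Longrightarrow> 0 \<le> s x" "\<And>x y. 0 < x \<Longrightarrow> x \<le> y \<Longrightarrow> s y \<le> s x"
    using concave_mono_supergradient[OF f] by metis
  have "0 \<le> (\<Sum>i<n. s (x i) * (x i - w i))"
    using maj by (intro abel_sum_nonneg) (auto simp: s pos x sum_subtractf)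
  also have "\<dots> \<le> (\<Sum>i<n. f (x i) - f (w i))"
  proof (rule sum_mono)
    fix i assume "i \<in> {..<n}"
    then show "s (x i) * (x i - w i) \<le> f (x i) - f (w i)"
      using s(1)[OF pos, of i i] by (simp add: algebra_simps)
  qed
  finally show ?thesis by (simp add: sum_subtractf)
qed

text \<open>Each step moves mass from the last surplus index \<open>i\<close> before the first deficit index \<open>j\<close>
  of \<open>w\<close> until one of the two entries agrees with \<open>x\<close>, so the number of disagreements drops.\<close>

lemma weak_majorization_induct:
  fixes x w :: "nat \<Rightarrow> real"
  assumes x: "\<And>i j. i \<le> j \<Longrightarrow> j < n \<Longrightarrow> x j \<le> x i"
    and maj: "\<And>k. k \<le> n \<Longrightarrow> (\<Sum>i<k. x i) \<le> (\<Sum>i<k. w i)"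
    and averaging: "\<And>w i j \<theta>. P w \<Longrightarrow> i < n \<Longrightarrow> j < n \<Longrightarrow> 0 \<le> \<theta> \<Longrightarrow> \<theta> \<le> 1 \<Longrightarrow>
      P (\<lambda>k. (1 - \<theta>) * w k + \<theta> * w (transpose i j k))"
    and dominated: "\<And>w. P w \<Longrightarrow> (\<And>i. i < n \<Longrightarrow> x i \<le> w i) \<Longrightarrow> P x"
    and P: "P w"
  shows "P x"
  using maj P
proof (induction "card {i. i < n \<and> x i \<noteq> w i}" arbitrary: w rule: less_induct)
  case less
  show ?case
  proof (cases "\<forall>i<n. x i \<le> w i")
    case True
    then show ?thesis using dominated less.prems(2) by blast
  next
    case False
    define j where "j = (LEAST j. j < n \<and> w j < x j)"
    have j: "j < n" "w j < x j"
      using False LeastI_ex[of "\<lambda>j. j < n \<and> w j < x j"] unfolding j_def not_all not_imp not_le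
      by blast+
    have before_j: "x i \<le> w i" if "i < j" for i
      using not_less_Least[of i "\<lambda>j. j < n \<and> w j < x j"] that j unfolding j_def by auto
    \<comment> \<open>Without an earlier surplus, the deficit at \<open>j\<close> would make the
      prefix sum of length \<open>Suc j\<close> violate the majorization.\<close>
    have ex: "\<exists>i<j. x i < w i"
    proof (rule ccontr)
      assume "\<not> ?thesis"
      then have "(\<Sum>i<j. w i) \<le> (\<Sum>i<j. x i)" by (intro sum_mono) auto
      with less.prems(1)[of "Suc j"] j show False by simp
    qed
    define i where "i = Max {i. i < j \<and> x i < w i}"
    have "i \<in> {i. i < j \<and> x i < w i}"
      unfolding i_def by (rule Max_in) (use ex in auto)
    then have i: "i < j" "x i < w i" by auto
    have between: "x k = w k" if "i < k" "k < j" for k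
    proof -
      have "k \<le> i" if "x k < w k"
        unfolding i_def by (rule Max_ge) (use that \<open>k < j\<close> in auto)
      with before_j[of k] that show ?thesis by force
    qed
    define \<delta> where "\<delta> = min (w i - x i) (x j - w j)"
    have \<delta>: "0 < \<delta>" "\<delta> \<le> w i - x i" "\<delta> \<le> x j - w j" using i j by (auto simp: \<delta>_def)
    \<comment> \<open>Since \<open>x j \<le> x i\<close>, the distance \<open>w i - w j\<close> is
      at least the surplus at \<open>i\<close> plus the deficit at \<open>j\<close>. Hence moving
      \<open>\<delta>\<close> is a genuine averaging with parameter in the unit interval.\<close>
    have gap: "\<delta> \<le> w i - w j" "0 < w i - w j" using \<delta> x[of i j] i j by auto
    define \<theta> where "\<theta> = \<delta> / (w i - w j)"
    have \<theta>: "0 \<le> \<theta>" "\<theta> \<le> 1" "\<theta> * (w i - w j) = \<delta>"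
      using gap \<delta> by (auto simp: \<theta>_def divide_simps)
    define w' where "w' k = (1 - \<theta>) * w k + \<theta> * w (transpose i j k)" for k
    have w'_i: "w' i = w i - \<delta>" and w'_j: "w' j = w j + \<delta>"
      using \<theta>(3) by (auto simp: w'_def algebra_simps)
    have w'_other: "w' k = w k" if "k \<noteq> i" "k \<noteq> j" for k
      using that by (simp add: w'_def transpose_def algebra_simps)
    have w'_eq: "w' k = w k + ((if k = j then \<delta> else 0) - (if k = i then \<delta> else 0))" for k
      using w'_i w'_j w'_other[of k] i by auto
    have w'_sum: "(\<Sum>a<k. w' a) = (\<Sum>a<k. w a) + ((if j < k then \<delta> else 0) - (if i < k then \<delta> else 0))" for k
      unfolding w'_eq by (simp add: sum.distrib sum_subtractf)
    have "P w'"
      unfolding w'_def using less.prems(2) i j \<theta> by (intro averaging) auto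
    moreover have "(\<Sum>a<k. x a) \<le> (\<Sum>a<k. w' a)" if k: "k \<le> n" for k
    \<comment> \<open>Only prefixes that contain \<open>i\<close> but not \<open>j\<close> lose
      mass. There the inequality survives termwise: it holds up to \<open>i\<close>, entry
      \<open>i\<close> still has \<open>w' i \<ge> x i\<close>, and from there to \<open>j\<close>
      both vectors agree because \<open>i\<close> is the last surplus.\<close>
    proof (cases "i < k \<and> k \<le> j")
      case True
      have split: "(\<Sum>a<k. g a) = (\<Sum>a<i. g a) + g i + (\<Sum>a\<in>{i<..<k}. g a)" for g :: "nat \<Rightarrow> real"
      proof -
        have "{..<k} = insert i ({..<i} \<union> {i<..<k})" using True by auto
        moreover have "{..<i} \<inter> {i<..<k} = {}" by auto
        ultimately show ?thesis by (simp add: sum.union_disjoint)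
      qed
      have "(\<Sum>a\<in>{i<..<k}. x a) = (\<Sum>a\<in>{i<..<k}. w a)"
        using True by (intro sum.cong) (auto simp: between)
      with split[of x] split[of w] less.prems(1)[of i] i j \<delta> True show ?thesis
        by (simp add: w'_sum)
    next
      case False
      then show ?thesis using less.prems(1)[OF k] i by (auto simp: w'_sum)
    qed
    moreover have "card {a. a < n \<and> x a \<noteq> w' a} < card {a. a < n \<and> x a \<noteq> w a}"
    proof (rule psubset_card_mono)
      have "x a \<noteq> w a" if "x a \<noteq> w' a" for a
        using that w'_other[of a] i(2) j(2) by (cases "a = i \<or> a = j") auto
      moreover obtain a where "a < n" "x a \<noteq> w a" "w' a = x a"
      proof (cases "w i - x i \<le> x j - w j")
        case True
        then show ?thesis using that[of i] w'_i i j by (simp add: \<delta>_def)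
      next
        case False
        then show ?thesis using that[of j] w'_j j by (simp add: \<delta>_def)
      qed
      ultimately show "{a. a < n \<and> x a \<noteq> w' a} \<subset> {a. a < n \<and> x a \<noteq> w a}"
        by (metis (mono_tags, lifting) mem_Collect_eq psubsetI subsetI)
    qed simp
    ultimately show ?thesis using less.hyps by blast
  qed
qed

section \<open>The spectral theorem for Hermitian matrices\<close>

lemma mat_adjoint_carrier:
  "A \<in> carrier_mat n m \<Longrightarrow> mat_adjoint A \<in> carrier_mat m n"
  by (auto simp: mat_adjoint_def mat_of_rows_def)

lemma mat_adjoint_index:
  fixes A :: "complex mat"
  assumes "A \<in> carrier_mat n m" "i < m" "j < n"
  shows "mat_adjoint A $$ (i, j) = cnj (A $$ (j, i))"
  using assms by (auto simp: mat_adjoint_def mat_of_rows_index cols_def)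

lemma index_mult_mat_sum:
  assumes "A \<in> carrier_mat n m" "B \<in> carrier_mat m p" "i < n" "j < p"
  shows "(A * B) $$ (i, j) = (\<Sum>k<m. A $$ (i, k) * B $$ (k, j))"
  using assms by (simp add: scalar_prod_def lessThan_atLeast0)

lemma mat_adjoint_adjoint:
  fixes A :: "complex mat"
  assumes A: "A \<in> carrier_mat n m"
  shows "mat_adjoint (mat_adjoint A) = A"
proof (rule eq_matI)
  note A' = mat_adjoint_carrier[OF A]
  show "mat_adjoint (mat_adjoint A) $$ (i, j) = A $$ (i, j)" if "i < dim_row A" "j < dim_col A" for i j
    using that A by (simp add: mat_adjoint_index[OF A'] mat_adjoint_index[OF A])
qed (use A mat_adjoint_carrier[OF mat_adjoint_carrier[OF A]] in auto)

lemma mat_adjoint_mult: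
  fixes A B :: "complex mat"
  assumes A: "A \<in> carrier_mat n m" and B: "B \<in> carrier_mat m p"
  shows "mat_adjoint (A * B) = mat_adjoint B * mat_adjoint A"
proof (rule eq_matI)
  note c = A B mult_carrier_mat[OF A B] mat_adjoint_carrier[OF A] mat_adjoint_carrier[OF B]
  fix i j
  assume "i < dim_row (mat_adjoint B * mat_adjoint A)" "j < dim_col (mat_adjoint B * mat_adjoint A)"
  then have ij: "i < p" "j < n" using c by auto
  show "mat_adjoint (A * B) $$ (i, j) = (mat_adjoint B * mat_adjoint A) $$ (i, j)"
    using ij by (simp add: mat_adjoint_index[OF c(3)] index_mult_mat_sum[OF c(1,2)]
        index_mult_mat_sum[OF c(5,4)] mat_adjoint_index[OF c(1)] mat_adjoint_index[OF c(2)]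
        mult.commute del: index_mult_mat)
qed (use mat_adjoint_carrier[OF A] mat_adjoint_carrier[OF B]
    mat_adjoint_carrier[OF mult_carrier_mat[OF A B]] in auto)

lemma mat_sandwich_assoc:
  fixes A :: "'a :: semiring_0 mat"
  assumes "A \<in> carrier_mat l l" "B \<in> carrier_mat l l" "C \<in> carrier_mat l l"
    "D \<in> carrier_mat l l" "E \<in> carrier_mat l l"
  shows "A * (B * C * D) * E = (A * B) * C * (D * E)"
proof -
  note [simp] = assms mult_carrier_mat[of _ l l _ l] assoc_mult_mat[of _ l l _ l _ l]
  show ?thesis by simp
qed

lemma hermitian_mat_iff:
  "hermitian_mat l A \<longleftrightarrow> A \<in> carrier_mat l l \<and> (\<forall>i<l. \<forall>j<l. A $$ (i, j) = cnj (A $$ (j, i)))"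
proof -
  have "mat_adjoint A = A \<longleftrightarrow> (\<forall>i<l. \<forall>j<l. A $$ (i, j) = cnj (A $$ (j, i)))"
    if A: "A \<in> carrier_mat l l"
  proof -
    have "mat_adjoint A = A \<longleftrightarrow> (\<forall>i<l. \<forall>j<l. mat_adjoint A $$ (i, j) = A $$ (i, j))"
      using A mat_adjoint_carrier[OF A] by (auto simp only: mat_eq_iff carrier_matD)
    then show ?thesis using mat_adjoint_index[OF A] by metis
  qed
  then show ?thesis by (auto simp only: hermitian_mat_def)
qed

definition real_diag :: "nat \<Rightarrow> (nat \<Rightarrow> real) \<Rightarrow> complex mat" where
  "real_diag l d = mat_diag l (\<lambda>i. complex_of_real (d i))"

lemma real_diag_carrier [simp]: "real_diag l d \<in> carrier_mat l l"
  by (simp add: real_diag_def)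

lemma real_diag_index:
  "i < l \<Longrightarrow> j < l \<Longrightarrow> real_diag l d $$ (i, j) = (if i = j then complex_of_real (d i) else 0)"
  by (simp add: real_diag_def mat_diag_def)

lemma real_diag_cong: "(\<And>i. i < l \<Longrightarrow> d i = e i) \<Longrightarrow> real_diag l d = real_diag l e"
  unfolding real_diag_def mat_diag_def by (rule eq_matI) auto

lemma unitary_mat_carrier: "unitary_mat l U \<Longrightarrow> U \<in> carrier_mat l l"
  by (simp add: unitary_mat_def)

lemma unitary_mat_adjoint: "unitary_mat l U \<Longrightarrow> unitary_mat l (mat_adjoint U)"
  using mat_adjoint_adjoint[of U l l] mat_adjoint_carrier[of U l l] by (simp add: unitary_mat_def)

lemma mat_adjoint_one: "mat_adjoint (1\<^sub>m l :: complex mat) = 1\<^sub>m l"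
  by (rule eq_matI) (auto simp: mat_adjoint_index[OF one_carrier_mat]
      carrier_matD[OF mat_adjoint_carrier[OF one_carrier_mat]])

lemma unitary_mat_one: "unitary_mat l (1\<^sub>m l)"
  by (simp add: unitary_mat_def mat_adjoint_one)

lemma unitary_matI:
  assumes "U \<in> carrier_mat l l" "mat_adjoint U * U = 1\<^sub>m l"
  shows "unitary_mat l U"
  using assms mat_mult_left_right_inverse[OF mat_adjoint_carrier[OF assms(1)] assms(1,2)]
  by (simp add: unitary_mat_def)

lemma unitary_mat_mult:
  assumes U: "unitary_mat l U" and V: "unitary_mat l V"
  shows "unitary_mat l (U * V)"
proof (rule unitary_matI)
  have c: "U \<in> carrier_mat l l" "V \<in> carrier_mat l l"
    "mat_adjoint U \<in> carrier_mat l l" "mat_adjoint V \<in> carrier_mat l l"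
    using U V by (auto simp: unitary_mat_def intro: mat_adjoint_carrier)
  show "U * V \<in> carrier_mat l l" using c by simp
  have "mat_adjoint (U * V) * (U * V) = mat_adjoint V * (mat_adjoint U * (U * V))"
    using c by (simp add: mat_adjoint_mult[OF c(1,2)] assoc_mult_mat[of _ l l _ l _ l])
  also have "mat_adjoint U * (U * V) = V"
    using c U by (simp add: assoc_mult_mat[of _ l l _ l _ l, symmetric] unitary_mat_def)
  finally show "mat_adjoint (U * V) * (U * V) = 1\<^sub>m l"
    using V by (simp add: unitary_mat_def)
qed

lemma real_diag_triple_index:
  assumes U: "U \<in> carrier_mat l l" and V: "V \<in> carrier_mat l l" and ij: "i < l" "j < l"
  shows "(U * real_diag l d * V) $$ (i, j) = (\<Sum>k<l. U $$ (i, k) * complex_of_real (d k) * V $$ (k, j))"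
proof -
  have "U * real_diag l d = mat l l (\<lambda>(i, j). U $$ (i, j) * complex_of_real (d j))"
    unfolding real_diag_def by (rule mat_diag_mult_right[OF U])
  then show ?thesis
    using assms by (simp add: index_mult_mat_sum[of _ l l _ l] del: index_mult_mat)
qed

lemma unitary_conj_index:
  assumes U: "U \<in> carrier_mat l l" and i: "i < l" and j: "j < l"
  shows "(U * real_diag l d * mat_adjoint U) $$ (i, j) =
    (\<Sum>k<l. U $$ (i, k) * complex_of_real (d k) * cnj (U $$ (j, k)))"
  using real_diag_triple_index[OF U mat_adjoint_carrier[OF U] i j] j
  by (simp add: mat_adjoint_index[OF U])

lemma unitary_col_norm:
  assumes U: "unitary_mat l U" and i: "i < l"
  shows "(\<Sum>k<l. (cmod (U $$ (k, i)))\<^sup>2) = 1" "(\<Sum>k<l. (cmod (U $$ (i, k)))\<^sup>2) = 1"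
proof -
  have c: "U \<in> carrier_mat l l" "mat_adjoint U \<in> carrier_mat l l"
    using U by (auto simp: unitary_mat_def intro: mat_adjoint_carrier)
  have "complex_of_real (\<Sum>k<l. (cmod (U $$ (k, i)))\<^sup>2) = (mat_adjoint U * U) $$ (i, i)"
    using i by (simp add: index_mult_mat_sum[OF c(2,1)] mat_adjoint_index[OF c(1)]
        complex_norm_square[unfolded of_real_power] mult.commute del: index_mult_mat)
  also have "\<dots> = 1" using U i by (simp add: unitary_mat_def)
  finally show "(\<Sum>k<l. (cmod (U $$ (k, i)))\<^sup>2) = 1" by (simp only: of_real_eq_1_iff)
  have "complex_of_real (\<Sum>k<l. (cmod (U $$ (i, k)))\<^sup>2) = (U * mat_adjoint U) $$ (i, i)"
    using i by (simp add: index_mult_mat_sum[OF c(1,2)] mat_adjoint_index[OF c(1)]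
        complex_norm_square[unfolded of_real_power] del: index_mult_mat)
  also have "\<dots> = 1" using U i by (simp add: unitary_mat_def)
  finally show "(\<Sum>k<l. (cmod (U $$ (i, k)))\<^sup>2) = 1" by (simp only: of_real_eq_1_iff)
qed

lemma unitary_completion:
  fixes v :: "complex vec"
  assumes v: "v \<in> carrier_vec n" and v0: "v \<noteq> 0\<^sub>v n" and n: "0 < n"
  obtains W c where "unitary_mat n W" and "col W 0 = c \<cdot>\<^sub>v v"
proof -
  interpret cof_vec_space n "TYPE(complex)" .
  define b where "b = basis_completion v"
  define ws where "ws = gram_schmidt n b"
  from basis_completion[OF v v0, folded b_def]
  have dist_b: "distinct b" and indep: "\<not> lin_dep (set b)" and b: "set b \<subseteq> carrier_vec n"
    and hdb: "hd b = v" and len_b: "length b = n" by auto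
  from hdb len_b n obtain vs where bv: "b = v # vs" by (cases b) auto
  from gram_schmidt_result[OF b dist_b indep refl, folded ws_def]
  have ws: "set ws \<subseteq> carrier_vec n" "corthogonal ws" "length ws = n"
    by (auto simp: len_b)
  from gram_schmidt_hd[OF v, of vs, folded bv] have hdws: "hd ws = v" unfolding ws_def .
  have ws0: "ws ! 0 = v" using hdws ws n by (cases ws) auto
  have wsc: "ws ! i \<in> carrier_vec n" if "i < n" for i using ws that by auto
  have ip: "ws ! i \<bullet>c ws ! j = (\<Sum>a<n. cnj (ws ! j $ a) * (ws ! i $ a))" if "i < n" "j < n" for i j
    using wsc[OF that(1)] wsc[OF that(2)]
    by (simp add: scalar_prod_def lessThan_atLeast0 mult.commute)
  \<comment> \<open>Gram-Schmidt only makes the vectors orthogonal; \<open>q\<close> holds the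
    squared lengths by which the columns of \<open>W\<close> are normalized. The first vector is
    left unchanged by the process, so column 0 is a multiple of \<open>v\<close>.\<close>
  define q where "q j = (\<Sum>a<n. (cmod (ws ! j $ a))\<^sup>2)" for j
  have q: "complex_of_real (q j) = ws ! j \<bullet>c ws ! j" if "j < n" for j
    by (simp add: ip that q_def complex_norm_square[unfolded of_real_power] mult.commute)
  have q_pos: "0 < q j" if "j < n" for j
  proof -
    have "q j \<noteq> 0"
      using q[OF that] corthogonalD[OF ws(2), of j j] ws that by auto
    moreover have "0 \<le> q j" by (simp add: q_def sum_nonneg)
    ultimately show ?thesis by simp
  qed
  define W where "W = mat n n (\<lambda>(i, j). ws ! j $ i / complex_of_real (sqrt (q j)))"
  have W: "W \<in> carrier_mat n n" by (simp add: W_def)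
  have "unitary_mat n W"
  proof (rule unitary_matI[OF W], rule eq_matI)
    fix i j assume "i < dim_row (1\<^sub>m n :: complex mat)" "j < dim_col (1\<^sub>m n :: complex mat)"
    then have ij: "i < n" "j < n" by auto
    have "(mat_adjoint W * W) $$ (i, j) = (\<Sum>k<n. cnj (W $$ (k, i)) * W $$ (k, j))"
      using ij by (simp add: index_mult_mat_sum[OF mat_adjoint_carrier[OF W] W]
          mat_adjoint_index[OF W] del: index_mult_mat)
    also have "\<dots> = (\<Sum>k<n. cnj (ws ! i $ k) * (ws ! j $ k)) /
        (complex_of_real (sqrt (q i)) * complex_of_real (sqrt (q j)))"
      unfolding sum_divide_distrib by (rule sum.cong) (use ij in \<open>auto simp: W_def\<close>)
    also have "\<dots> = (ws ! j \<bullet>c ws ! i) / (complex_of_real (sqrt (q i)) * complex_of_real (sqrt (q j)))"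
      by (simp add: ip ij)
    also have "\<dots> = 1\<^sub>m n $$ (i, j)"
    proof (cases "i = j")
      case True
      have "complex_of_real (sqrt (q j)) * complex_of_real (sqrt (q j)) = complex_of_real (q j)"
        using q_pos[OF ij(2)] by (simp flip: of_real_mult)
      with True q_pos[OF ij(2)] ij show ?thesis by (simp flip: q)
    next
      case False
      with corthogonalD[OF ws(2), of j i] ij ws show ?thesis by simp
    qed
    finally show "(mat_adjoint W * W) $$ (i, j) = 1\<^sub>m n $$ (i, j)" .
  qed (use W mat_adjoint_carrier[OF W] in auto)
  moreover have "col W 0 = (1 / complex_of_real (sqrt (q 0))) \<cdot>\<^sub>v v"
    by (rule eq_vecI) (use n v in \<open>auto simp: W_def ws0\<close>)
  ultimately show ?thesis by (rule that)
qed

text \<open>Deflation: in a unitary basis starting with an eigenvector, a Hermitian matrix splits off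
  a one-dimensional block.\<close>

lemma hermitian_diagonalizable:
  "hermitian_mat n A \<Longrightarrow> \<exists>U d. unitary_mat n U \<and> A = U * real_diag n d * mat_adjoint U"
proof (induction n arbitrary: A)
  case 0
  then have "A = 1\<^sub>m 0 * real_diag 0 (\<lambda>_. 0) * mat_adjoint (1\<^sub>m 0)"
    by (intro eq_matI) (auto simp: hermitian_mat_def mat_adjoint_def)
  then show ?case using unitary_mat_one by blast
next
  case (Suc n)
  let ?N = "Suc n"
  have A: "A \<in> carrier_mat ?N ?N" using Suc.prems by (simp add: hermitian_mat_def)
  obtain as where as: "char_poly A = (\<Prod>a\<leftarrow>as. [:- a, 1:])" "length as = ?N"
    using char_poly_factorized[OF A] by blast
  then obtain e as' where "as = e # as'" by (cases as) auto
  then have "eigenvalue A e" unfolding eigenvalue_root_char_poly[OF A] as by simp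
  then obtain v where v: "v \<in> carrier_vec ?N" "v \<noteq> 0\<^sub>v ?N" "A *\<^sub>v v = e \<cdot>\<^sub>v v"
    using A by (auto simp: eigenvalue_def eigenvector_def)
  obtain W c where W: "unitary_mat ?N W" and col: "col W 0 = c \<cdot>\<^sub>v v"
    using unitary_completion[OF v(1,2)] by blast
  define W' where "W' = mat_adjoint W"
  have Wc: "W \<in> carrier_mat ?N ?N" "W' \<in> carrier_mat ?N ?N"
    using W mat_adjoint_carrier by (auto simp: W'_def unitary_mat_def)
  have WW': "W * W' = 1\<^sub>m ?N" "W' * W = 1\<^sub>m ?N" using W by (auto simp: W'_def unitary_mat_def)
  define B where "B = W' * A * W"
  have B: "B \<in> carrier_mat ?N ?N" using A Wc by (simp add: B_def)
  have "mat_adjoint B = mat_adjoint W * (mat_adjoint A * mat_adjoint W')"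
    unfolding B_def using A Wc mat_adjoint_carrier[OF A] mat_adjoint_carrier[OF Wc(1)]
      mat_adjoint_carrier[OF Wc(2)]
    by (simp add: mat_adjoint_mult[of _ ?N ?N _ ?N] assoc_mult_mat[of _ ?N ?N _ ?N _ ?N])
  also have "\<dots> = B"
    using Suc.prems A Wc mat_adjoint_adjoint[OF Wc(1)]
    by (simp add: B_def W'_def hermitian_mat_def assoc_mult_mat[of _ ?N ?N _ ?N _ ?N])
  finally have B_herm: "hermitian_mat ?N B" using B by (simp add: hermitian_mat_def)
  have B_cnj: "B $$ (i, j) = cnj (B $$ (j, i))" if "i < ?N" "j < ?N" for i j
    using B_herm that unfolding hermitian_mat_iff by blast
  have AW0: "col (A * W) 0 = e \<cdot>\<^sub>v col W 0"
  proof -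
    have "col (A * W) 0 = A *\<^sub>v col W 0"
      using A Wc by (intro col_mult2[of _ ?N ?N _ ?N]) auto
    also have "\<dots> = e \<cdot>\<^sub>v col W 0"
      unfolding col using A v by (simp add: mult_mat_vec smult_smult_assoc mult.commute)
    finally show ?thesis .
  qed
  have B0: "B $$ (i, 0) = (if i = 0 then e else 0)" if i: "i < ?N" for i
  proof -
    have "B $$ (i, 0) = (W' * (A * W)) $$ (i, 0)"
      using A Wc by (simp add: B_def assoc_mult_mat[of _ ?N ?N _ ?N _ ?N])
    also have "\<dots> = row W' i \<bullet> (e \<cdot>\<^sub>v col W 0)"
      using i A Wc AW0 by (subst index_mult_mat) auto
    also have "\<dots> = e * (W' * W) $$ (i, 0)"
      using i Wc by (subst index_mult_mat) auto
    also have "\<dots> = (if i = 0 then e else 0)"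
      using i by (simp add: WW')
    finally show ?thesis .
  qed
  \<comment> \<open>Column 0 vanishes off the diagonal because it is the image of an eigenvector;
    Hermitian symmetry transfers this to row 0, and the same symmetry makes the corner entry
    \<open>e\<close> real.\<close>
  have B0': "B $$ (0, j) = 0" if "j < ?N" "j \<noteq> 0" for j
    using B_cnj[of 0 j] B0[of j] that by simp
  have e: "e = complex_of_real (Re e)"
    using B_cnj[of 0 0] B0[of 0] by (simp add: complex_eq_iff)
  define C where "C = mat n n (\<lambda>(i, j). B $$ (Suc i, Suc j))"
  have "hermitian_mat n C"
    unfolding hermitian_mat_iff
  proof (intro conjI allI impI)
    show "C $$ (i, j) = cnj (C $$ (j, i))" if "i < n" "j < n" for i j
      using B_cnj[of "Suc i" "Suc j"] that by (simp add: C_def)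
  qed (simp add: C_def)
  then obtain U d where U: "unitary_mat n U" and CU: "C = U * real_diag n d * mat_adjoint U"
    using Suc.IH by blast
  have Uc: "U \<in> carrier_mat n n" using U by (simp add: unitary_mat_def)
  have C_index: "B $$ (Suc i, Suc j) = (\<Sum>k<n. U $$ (i, k) * complex_of_real (d k) * cnj (U $$ (j, k)))"
    if "i < n" "j < n" for i j
  proof -
    have "B $$ (Suc i, Suc j) = C $$ (i, j)" using that by (simp add: C_def)
    then show ?thesis unfolding CU by (simp only: unitary_conj_index[OF Uc that])
  qed
  \<comment> \<open>\<open>V\<close> is the block sum of the scalar 1 and \<open>U\<close>, and
    \<open>f\<close> prepends the eigenvalue just split off to the diagonal of the smaller
    block.\<close>
  define V where "V = mat ?N ?N (\<lambda>(i, j). case (i, j) of (0, 0) \<Rightarrow> 1 | (Suc i, Suc j) \<Rightarrow> U $$ (i, j) | _ \<Rightarrow> 0)"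
  define f where "f = case_nat (Re e) d"
  have V: "V \<in> carrier_mat ?N ?N" by (simp add: V_def)
  have V_index [simp]: "V $$ (0, 0) = 1" "j < n \<Longrightarrow> V $$ (0, Suc j) = 0"
    "i < n \<Longrightarrow> V $$ (Suc i, 0) = 0" "i < n \<Longrightarrow> j < n \<Longrightarrow> V $$ (Suc i, Suc j) = U $$ (i, j)" for i j
    by (auto simp: V_def)
  have VU: "unitary_mat ?N V"
  proof (rule unitary_matI[OF V], rule eq_matI)
    fix i j assume "i < dim_row (1\<^sub>m ?N :: complex mat)" "j < dim_col (1\<^sub>m ?N :: complex mat)"
    then have ij: "i < ?N" "j < ?N" by auto
    have "(mat_adjoint V * V) $$ (i, j) = (\<Sum>k<?N. cnj (V $$ (k, i)) * V $$ (k, j))"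
      using ij by (simp add: index_mult_mat_sum[OF mat_adjoint_carrier[OF V] V]
          mat_adjoint_index[OF V] del: index_mult_mat sum.lessThan_Suc)
    also have "\<dots> = 1\<^sub>m ?N $$ (i, j)"
    proof (cases i)
      case 0
      with ij show ?thesis
        by (cases j) (simp_all add: sum.lessThan_Suc_shift del: sum.lessThan_Suc)
    next
      case i: (Suc i')
      show ?thesis
      proof (cases j)
        case 0
        with i ij show ?thesis by (simp add: sum.lessThan_Suc_shift del: sum.lessThan_Suc)
      next
        case j: (Suc j')
        have "(\<Sum>k<n. cnj (U $$ (k, i')) * U $$ (k, j')) = (mat_adjoint U * U) $$ (i', j')"
          using i j ij by (simp add: index_mult_mat_sum[OF mat_adjoint_carrier[OF Uc] Uc]
              mat_adjoint_index[OF Uc] del: index_mult_mat)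
        also have "\<dots> = 1\<^sub>m n $$ (i', j')" using U by (simp add: unitary_mat_def)
        finally show ?thesis
          using i j ij by (simp add: sum.lessThan_Suc_shift del: sum.lessThan_Suc)
      qed
    qed
    finally show "(mat_adjoint V * V) $$ (i, j) = 1\<^sub>m ?N $$ (i, j)" .
  qed (use V mat_adjoint_carrier[OF V] in auto)
  have BV: "B = V * real_diag ?N f * mat_adjoint V"
  proof (rule eq_matI)
    fix i j assume "i < dim_row (V * real_diag ?N f * mat_adjoint V)"
      "j < dim_col (V * real_diag ?N f * mat_adjoint V)"
    then have ij: "i < ?N" "j < ?N" using V mat_adjoint_carrier[OF V] by auto
    show "B $$ (i, j) = (V * real_diag ?N f * mat_adjoint V) $$ (i, j)"
      unfolding unitary_conj_index[OF V ij]
      using ij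
      by (cases i; cases j)
        (simp_all add: sum.lessThan_Suc_shift B0 B0' C_index f_def e[symmetric] del: sum.lessThan_Suc)
  qed (use B V mat_adjoint_carrier[OF V] in auto)
  have V': "mat_adjoint V \<in> carrier_mat ?N ?N" using mat_adjoint_carrier[OF V] .
  have "A = (W * W') * A * (W * W')" using A by (simp add: WW')
  also have "\<dots> = W * B * W'"
    using A Wc by (simp add: B_def assoc_mult_mat[of _ ?N ?N _ ?N _ ?N])
  also have "\<dots> = (W * V) * real_diag ?N f * mat_adjoint (W * V)"
    unfolding mat_adjoint_mult[OF Wc(1) V] BV
    unfolding W'_def by (rule mat_sandwich_assoc) (use Wc V V' in \<open>auto simp: W'_def\<close>)
  finally show ?case
    by (intro exI[of _ "W * V"] exI[of _ f] conjI unitary_mat_mult W VU)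
qed

lemma mat_triple_index:
  assumes U: "U \<in> carrier_mat l l" and A: "A \<in> carrier_mat l l" and V: "V \<in> carrier_mat l l"
    and ij: "i < l" "j < l"
  shows "(U * A * V) $$ (i, j) = (\<Sum>b<l. \<Sum>a<l. U $$ (i, a) * A $$ (a, b) * V $$ (b, j))"
proof -
  have "(U * A * V) $$ (i, j) = (\<Sum>b<l. (U * A) $$ (i, b) * V $$ (b, j))"
    using assms by (intro index_mult_mat_sum[of _ l l _ l]) auto
  also have "\<dots> = (\<Sum>b<l. \<Sum>a<l. U $$ (i, a) * A $$ (a, b) * V $$ (b, j))"
  proof (rule sum.cong)
    fix b assume "b \<in> {..<l}"
    then have "(U * A) $$ (i, b) = (\<Sum>a<l. U $$ (i, a) * A $$ (a, b))"
      using ij by (intro index_mult_mat_sum[OF U A]) auto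
    then show "(U * A) $$ (i, b) * V $$ (b, j) = (\<Sum>a<l. U $$ (i, a) * A $$ (a, b) * V $$ (b, j))"
      by (simp add: sum_distrib_right)
  qed simp
  finally show ?thesis .
qed

lemma hermitian_unitary_conj:
  assumes U: "U \<in> carrier_mat l l"
  shows "hermitian_mat l (U * real_diag l d * mat_adjoint U)"
  unfolding hermitian_mat_iff
proof (intro conjI allI impI)
  fix i j assume ij: "i < l" "j < l"
  show "(U * real_diag l d * mat_adjoint U) $$ (i, j) = cnj ((U * real_diag l d * mat_adjoint U) $$ (j, i))"
    unfolding unitary_conj_index[OF U ij] unitary_conj_index[OF U ij(2,1)]
    by (auto intro!: sum.cong)
qed (use U mat_adjoint_carrier[OF U] in auto)

lemma real_diag_conj_one: "1\<^sub>m l * real_diag l d * mat_adjoint (1\<^sub>m l) = real_diag l d"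
  by (simp add: mat_adjoint_one right_mult_one_mat[of _ l l] left_mult_one_mat[of _ l l])

lemma hermitian_real_diag: "hermitian_mat l (real_diag l d)"
  using hermitian_unitary_conj[OF one_carrier_mat, of l d] by (simp only: real_diag_conj_one)

section \<open>Ordered spectra\<close>

lemma proots_linear_factors: "proots (\<Prod>a\<leftarrow>as. [:- a, 1:]) = mset (as :: complex list)"
proof (induction as)
  case (Cons a as)
  have "(\<Prod>a\<leftarrow>as. [:- a, 1:]) \<noteq> 0" by (auto simp: prod_list_zero_iff)
  then show ?case using Cons by (simp add: proots_mult del: mult_pCons_left)
qed simp

text \<open>Conjugation is a similarity and keeps the characteristic polynomial, which for a
  diagonal matrix splits into the visible linear factors. Thus \<open>eigs\<close>, defined by
  polynomial roots, can be read off any diagonalization after sorting.\<close>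

lemma eigs_unitary_conj:
  assumes U: "unitary_mat l U"
  shows "eigs (U * real_diag l d * mat_adjoint U) = rev (sort (map d [0..<l]))"
proof -
  have c: "U \<in> carrier_mat l l" "mat_adjoint U \<in> carrier_mat l l"
    using U by (auto simp: unitary_mat_def intro: mat_adjoint_carrier)
  have "similar_mat_wit (U * real_diag l d * mat_adjoint U) (real_diag l d) U (mat_adjoint U)"
    by (rule similar_mat_witI[of _ _ l]) (use c U in \<open>auto simp: unitary_mat_def\<close>)
  then have "char_poly (U * real_diag l d * mat_adjoint U) = char_poly (real_diag l d)"
    by (intro char_poly_similar) (auto simp: similar_mat_def)
  also have "\<dots> = (\<Prod>a\<leftarrow>diag_mat (real_diag l d). [:- a, 1:])"
    by (rule char_poly_upper_triangular) (auto simp: upper_triangular_def real_diag_def mat_diag_def)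
  also have "diag_mat (real_diag l d) = map (\<lambda>i. complex_of_real (d i)) [0..<l]"
    by (auto simp: diag_mat_def real_diag_def mat_diag_def)
  finally have "proots (char_poly (U * real_diag l d * mat_adjoint U)) =
      mset (map (\<lambda>i. complex_of_real (d i)) [0..<l])"
    by (simp only: proots_linear_factors)
  then have "image_mset Re (proots (char_poly (U * real_diag l d * mat_adjoint U))) = mset (map d [0..<l])"
    by (simp only: mset_map[symmetric] map_map o_def Re_complex_of_real)
  then show ?thesis by (simp only: eigs_def sorted_list_of_multiset_mset)
qed

lemma length_eigs: "hermitian_mat l A \<Longrightarrow> length (eigs A) = l"
  using hermitian_diagonalizable[of l A] eigs_unitary_conj by force

lemma eigs_antimono:
  "i \<le> j \<Longrightarrow> j < length (eigs A) \<Longrightarrow> eigs A ! j \<le> eigs A ! i"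
  using sorted_rev_iff_nth_mono[of "eigs A"] by (simp add: eigs_def)

lemma rev_eigs_mono:
  "i \<le> j \<Longrightarrow> j < length (eigs A) \<Longrightarrow> rev (eigs A) ! i \<le> rev (eigs A) ! j"
  by (simp add: eigs_def sorted_nth_mono)

text \<open>Permuting the columns of a diagonalizing unitary permutes the diagonal, so the
  eigenvalues may be listed in any prescribed order. Both the increasing and the decreasing listing
  are taken from here, and so is the unitary that swaps two diagonal entries.\<close>

lemma hermitian_spectral:
  assumes A: "hermitian_mat l A" and e: "mset (map e [0..<l]) = mset (eigs A)"
  obtains U where "unitary_mat l U" and "A = U * real_diag l e * mat_adjoint U"
proof -
  obtain U d where U: "unitary_mat l U" and AU: "A = U * real_diag l d * mat_adjoint U"
    using hermitian_diagonalizable[OF A] by blast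
  have "mset (map e [0..<l]) = mset (map d [0..<l])"
    using e unfolding AU eigs_unitary_conj[OF U] by simp
  then obtain p where p: "p permutes {..<l}" and pe: "permute_list p (map d [0..<l]) = map e [0..<l]"
    using mset_eq_permutation[of "map e [0..<l]" "map d [0..<l]"] by auto
  have p_lt: "p i < l" if "i < l" for i using permutes_in_image[OF p] that by auto
  have de: "e i = d (p i)" if "i < l" for i
  proof -
    have "e i = permute_list p (map d [0..<l]) ! i" using that by (simp add: pe)
    also have "\<dots> = d (p i)" using that p p_lt[OF that] by (simp add: permute_list_nth)
    finally show ?thesis .
  qed
  define V where "V = mat l l (\<lambda>(i, j). U $$ (i, p j))"
  have c: "U \<in> carrier_mat l l" "V \<in> carrier_mat l l" "mat_adjoint V \<in> carrier_mat l l"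
    using U by (auto simp: unitary_mat_def V_def intro: mat_adjoint_carrier)
  have V_index: "V $$ (i, j) = U $$ (i, p j)" if "i < l" "j < l" for i j
    using that by (simp add: V_def)
  have "unitary_mat l V"
  proof (rule unitary_matI[OF c(2)], rule eq_matI)
    fix i j assume "i < dim_row (1\<^sub>m l :: complex mat)" "j < dim_col (1\<^sub>m l :: complex mat)"
    then have ij: "i < l" "j < l" by auto
    have "(mat_adjoint V * V) $$ (i, j) = (\<Sum>k<l. cnj (U $$ (k, p i)) * U $$ (k, p j))"
      using ij by (simp add: index_mult_mat_sum[OF c(3,2)] mat_adjoint_index[OF c(2)] V_index
          del: index_mult_mat)
    also have "\<dots> = (mat_adjoint U * U) $$ (p i, p j)"
      using ij p_lt by (simp add: index_mult_mat_sum[OF mat_adjoint_carrier[OF c(1)] c(1)]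
          mat_adjoint_index[OF c(1)] del: index_mult_mat)
    also have "\<dots> = 1\<^sub>m l $$ (i, j)"
      using U ij p_lt permutes_inj[OF p] by (auto simp: unitary_mat_def inj_eq)
    finally show "(mat_adjoint V * V) $$ (i, j) = 1\<^sub>m l $$ (i, j)" .
  qed (use c in auto)
  moreover have "A = V * real_diag l e * mat_adjoint V"
  proof (rule eq_matI)
    fix i j assume "i < dim_row (V * real_diag l e * mat_adjoint V)"
      "j < dim_col (V * real_diag l e * mat_adjoint V)"
    then have ij: "i < l" "j < l" using c by auto
    have "A $$ (i, j) = (\<Sum>k<l. U $$ (i, k) * complex_of_real (d k) * cnj (U $$ (j, k)))"
      unfolding AU by (rule unitary_conj_index[OF c(1) ij])
    also have "\<dots> = (\<Sum>k<l. U $$ (i, p k) * complex_of_real (d (p k)) * cnj (U $$ (j, p k)))"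
      by (rule sum.permute[OF p, unfolded o_def])
    also have "\<dots> = (\<Sum>k<l. V $$ (i, k) * complex_of_real (e k) * cnj (V $$ (j, k)))"
      by (rule sum.cong) (use ij in \<open>auto simp: V_def de\<close>)
    also have "\<dots> = (V * real_diag l e * mat_adjoint V) $$ (i, j)"
      by (rule unitary_conj_index[OF c(2) ij, symmetric])
    finally show "A $$ (i, j) = (V * real_diag l e * mat_adjoint V) $$ (i, j)" .
  qed (use A c in \<open>auto simp: hermitian_mat_def\<close>)
  ultimately show ?thesis by (rule that)
qed

lemma hermitian_spectral_eigs:
  assumes A: "hermitian_mat l A"
  obtains U where "unitary_mat l U" and "A = U * real_diag l (\<lambda>i. eigs A ! i) * mat_adjoint U"
proof -
  have "map (\<lambda>i. eigs A ! i) [0..<l] = eigs A"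
    using map_nth[of "eigs A"] length_eigs[OF A] by simp
  then have "mset (map (\<lambda>i. eigs A ! i) [0..<l]) = mset (eigs A)" by (rule arg_cong)
  from hermitian_spectral[OF A this] show ?thesis using that by blast
qed

lemma hermitian_spectral_rev_eigs:
  assumes A: "hermitian_mat l A"
  obtains U where "unitary_mat l U" and "A = U * real_diag l (\<lambda>i. rev (eigs A) ! i) * mat_adjoint U"
proof -
  have "map (\<lambda>i. rev (eigs A) ! i) [0..<l] = rev (eigs A)"
    using map_nth[of "rev (eigs A)"] length_eigs[OF A] by simp
  then have "mset (map (\<lambda>i. rev (eigs A) ! i) [0..<l]) = mset (eigs A)" by (metis mset_rev)
  from hermitian_spectral[OF A this] show ?thesis using that by blast
qed

section \<open>Definiteness and inversion through eigenvalues\<close>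

lemma unitary_conj_cancel:
  assumes U: "unitary_mat l U" and D: "D \<in> carrier_mat l l"
  shows "mat_adjoint U * (U * D * mat_adjoint U) * U = D"
proof -
  have c: "U \<in> carrier_mat l l" "mat_adjoint U \<in> carrier_mat l l"
    using U by (auto simp: unitary_mat_def intro: mat_adjoint_carrier)
  have "mat_adjoint U * (U * D * mat_adjoint U) * U = (mat_adjoint U * U) * D * (mat_adjoint U * U)"
    by (rule mat_sandwich_assoc) (use c D in auto)
  also have "\<dots> = D" using U D by (simp add: unitary_mat_def)
  finally show ?thesis .
qed

text \<open>The columns of \<open>U\<close> are eigenvectors of unit length; testing the quadratic
  form on them turns the definiteness of \<open>A\<close> into sign conditions on single
  eigenvalues.\<close>

lemma quadratic_form_col:
  assumes U: "unitary_mat l U" and A: "A = U * real_diag l d * mat_adjoint U" and i: "i < l"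
  shows "conjugate (col U i) \<bullet> (A *\<^sub>v col U i) = complex_of_real (d i)"
proof -
  have c: "U \<in> carrier_mat l l" "mat_adjoint U \<in> carrier_mat l l" "A \<in> carrier_mat l l"
    using U hermitian_unitary_conj[of U l d]
    by (auto simp: A unitary_mat_def hermitian_mat_def intro: mat_adjoint_carrier)
  have "row (mat_adjoint U) i = conjugate (col U i)"
    using c i by (intro eq_vecI) (auto simp: mat_adjoint_index[OF c(1)])
  moreover have "A *\<^sub>v col U i = col (A * U) i" by (rule col_mult2[OF c(3,1) i, symmetric])
  ultimately have "conjugate (col U i) \<bullet> (A *\<^sub>v col U i) = (mat_adjoint U * (A * U)) $$ (i, i)"
    using c i by (subst index_mult_mat) auto
  also have "mat_adjoint U * (A * U) = mat_adjoint U * A * U"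
    using c by (simp add: assoc_mult_mat[of _ l l _ l _ l])
  also have "\<dots> = real_diag l d" unfolding A by (rule unitary_conj_cancel[OF U real_diag_carrier])
  finally show ?thesis using i by (simp add: real_diag_index)
qed

lemma psd_eigs_nonneg:
  assumes A: "psd_mat l A" and i: "i < l"
  shows "0 \<le> eigs A ! i"
proof -
  have "hermitian_mat l A" using A by (simp add: psd_mat_def)
  then obtain U where U: "unitary_mat l U" "A = U * real_diag l (\<lambda>i. eigs A ! i) * mat_adjoint U"
    by (rule hermitian_spectral_eigs)
  have "0 \<le> Re (conjugate (col U i) \<bullet> (A *\<^sub>v col U i))"
    using A U(1) by (auto simp: psd_mat_def unitary_mat_def)
  then show ?thesis by (simp add: quadratic_form_col[OF U i])
qed

lemma pd_imp_psd: "pd_mat l A \<Longrightarrow> psd_mat l A"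
  unfolding pd_mat_def psd_mat_def hermitian_mat_def
  by (metis (no_types, lifting) less_eq_real_def conjugate_zero_vec scalar_prod_left_zero
      mult_mat_vec_carrier zero_complex.sel(1))

lemma pd_eigs_pos:
  assumes A: "pd_mat l A" and i: "i < l"
  shows "0 < eigs A ! i"
proof -
  have "hermitian_mat l A" using A by (simp add: pd_mat_def)
  then obtain U where U: "unitary_mat l U" "A = U * real_diag l (\<lambda>i. eigs A ! i) * mat_adjoint U"
    by (rule hermitian_spectral_eigs)
  have Uc: "U \<in> carrier_mat l l" using U by (simp add: unitary_mat_def)
  have "col U i \<noteq> 0\<^sub>v l"
  proof
    assume "col U i = 0\<^sub>v l"
    then have "U $$ (k, i) = 0" if "k < l" for k
      using that i Uc by (metis carrier_matD index_col index_zero_vec(1))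
    then show False using unitary_col_norm(1)[OF U(1) i] by simp
  qed
  then have "0 < Re (conjugate (col U i) \<bullet> (A *\<^sub>v col U i))"
    using A Uc by (auto simp: pd_mat_def)
  then show ?thesis by (simp add: quadratic_form_col[OF U i])
qed

lemma psd_real_diag:
  assumes "\<And>i. i < l \<Longrightarrow> 0 \<le> d i"
  shows "psd_mat l (real_diag l d)"
  unfolding psd_mat_def
proof (intro conjI ballI hermitian_real_diag)
  fix v :: "complex vec" assume v: "v \<in> carrier_vec l"
  have Dv: "(real_diag l d *\<^sub>v v) $ i = complex_of_real (d i) * v $ i" if i: "i < l" for i
  proof -
    have "(real_diag l d *\<^sub>v v) $ i = (\<Sum>k<l. real_diag l d $$ (i, k) * v $ k)"
      using i v real_diag_carrier[of l d]
      by (simp add: scalar_prod_def lessThan_atLeast0 del: real_diag_carrier)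
    also have "\<dots> = (\<Sum>k<l. if i = k then complex_of_real (d i) * v $ i else 0)"
      using i by (intro sum.cong) (auto simp: real_diag_index)
    finally show ?thesis using i by simp
  qed
  have "conjugate v \<bullet> (real_diag l d *\<^sub>v v) = (\<Sum>i<l. cnj (v $ i) * (complex_of_real (d i) * v $ i))"
    using v real_diag_carrier[of l d]
    by (simp add: scalar_prod_def lessThan_atLeast0 Dv[simplified] del: index_mult_mat_vec real_diag_carrier)
  also have "Re \<dots> = (\<Sum>i<l. d i * ((Re (v $ i))\<^sup>2 + (Im (v $ i))\<^sup>2))"
    unfolding Re_sum by (intro sum.cong) (auto simp: power2_eq_square algebra_simps)
  also have "\<dots> \<ge> 0" using assms by (intro sum_nonneg mult_nonneg_nonneg) auto
  finally show "0 \<le> Re (conjugate v \<bullet> (real_diag l d *\<^sub>v v))" .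
qed

lemma quadratic_form_sum:
  assumes A: "A \<in> carrier_mat l l" and v: "v \<in> carrier_vec l"
  shows "conjugate v \<bullet> (A *\<^sub>v v) = (\<Sum>i<l. \<Sum>j<l. cnj (v $ i) * A $$ (i, j) * v $ j)"
  using assms by (simp add: scalar_prod_def lessThan_atLeast0 sum_distrib_left mult.assoc)

lemma hermitian_combination:
  assumes "hermitian_mat l A" "hermitian_mat l B"
  shows "hermitian_mat l (complex_of_real s \<cdot>\<^sub>m A + complex_of_real t \<cdot>\<^sub>m B)"
  unfolding hermitian_mat_iff
proof (intro conjI allI impI)
  have c: "A \<in> carrier_mat l l" "B \<in> carrier_mat l l" using assms by (auto simp: hermitian_mat_def)
  then show "complex_of_real s \<cdot>\<^sub>m A + complex_of_real t \<cdot>\<^sub>m B \<in> carrier_mat l l" by simp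
  fix i j assume ij: "i < l" "j < l"
  then have "A $$ (i, j) = cnj (A $$ (j, i))" "B $$ (i, j) = cnj (B $$ (j, i))"
    using assms unfolding hermitian_mat_iff by blast+
  with c ij show "(complex_of_real s \<cdot>\<^sub>m A + complex_of_real t \<cdot>\<^sub>m B) $$ (i, j) =
      cnj ((complex_of_real s \<cdot>\<^sub>m A + complex_of_real t \<cdot>\<^sub>m B) $$ (j, i))"
    by simp
qed

lemma pd_convex_combination:
  assumes A: "pd_mat l A" and B: "pd_mat l B" and t: "0 \<le> t" "t \<le> 1"
  shows "pd_mat l (complex_of_real t \<cdot>\<^sub>m A + complex_of_real (1 - t) \<cdot>\<^sub>m B)"
  unfolding pd_mat_def
proof (intro conjI ballI impI)
  have h: "hermitian_mat l A" "hermitian_mat l B" using A B by (auto simp: pd_mat_def)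
  then have c: "A \<in> carrier_mat l l" "B \<in> carrier_mat l l" by (auto simp: hermitian_mat_def)
  let ?C = "complex_of_real t \<cdot>\<^sub>m A + complex_of_real (1 - t) \<cdot>\<^sub>m B"
  show C: "hermitian_mat l ?C" by (rule hermitian_combination[OF h])
  fix v :: "complex vec" assume v: "v \<in> carrier_vec l" "v \<noteq> 0\<^sub>v l"
  have "conjugate v \<bullet> (?C *\<^sub>v v) = complex_of_real t * (conjugate v \<bullet> (A *\<^sub>v v)) +
      complex_of_real (1 - t) * (conjugate v \<bullet> (B *\<^sub>v v))"
    using c v C by (simp add: quadratic_form_sum[of _ l] hermitian_mat_def sum_distrib_left
        sum.distrib[symmetric] algebra_simps)
  then have "Re (conjugate v \<bullet> (?C *\<^sub>v v)) =
      t * Re (conjugate v \<bullet> (A *\<^sub>v v)) + (1 - t) * Re (conjugate v \<bullet> (B *\<^sub>v v))"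
    by simp
  moreover have "0 < Re (conjugate v \<bullet> (A *\<^sub>v v))" "0 < Re (conjugate v \<bullet> (B *\<^sub>v v))"
    using A B v by (auto simp: pd_mat_def)
  ultimately show "0 < Re (conjugate v \<bullet> (?C *\<^sub>v v))"
    \<comment> \<open>At \<open>t = 0\<close> strict positivity comes from \<open>B\<close> alone;
      otherwise the contribution of \<open>A\<close> is already positive.\<close>
    using t by (cases "t = 0") (auto intro!: add_pos_nonneg)
qed

text \<open>Reciprocals on the diagonal of a spectral decomposition give a two-sided inverse, and
  such an inverse is unique, so the choice in \<open>mat_inv\<close> is determined. Starting from
  the increasing listing, the reciprocals come out decreasing, which is already the order of
  \<open>eigs\<close>.\<close>

lemma mat_inv_pd:
  assumes A: "pd_mat l A"
  shows "hermitian_mat l (mat_inv l A)" and "eigs (mat_inv l A) = map inverse (rev (eigs A))"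
proof -
  have h: "hermitian_mat l A" using A by (simp add: pd_mat_def)
  define d where "d i = rev (eigs A) ! i" for i
  have len: "length (eigs A) = l" by (rule length_eigs[OF h])
  obtain U where U: "unitary_mat l U" and AU: "A = U * real_diag l d * mat_adjoint U"
    unfolding d_def by (rule hermitian_spectral_rev_eigs[OF h])
  have d_pos: "0 < d i" if "i < l" for i
    using pd_eigs_pos[OF A, of "l - Suc i"] that len by (simp add: d_def rev_nth)
  have c: "U \<in> carrier_mat l l" "mat_adjoint U \<in> carrier_mat l l" "A \<in> carrier_mat l l"
    using U h by (auto simp: unitary_mat_def hermitian_mat_def intro: mat_adjoint_carrier)
  define B where "B = U * real_diag l (\<lambda>i. inverse (d i)) * mat_adjoint U"
  have B_herm: "hermitian_mat l B" unfolding B_def by (rule hermitian_unitary_conj[OF c(1)])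
  then have B: "B \<in> carrier_mat l l" by (simp add: hermitian_mat_def)
  have "A * B = U * real_diag l d * (mat_adjoint U * U) * (real_diag l (\<lambda>i. inverse (d i)) * mat_adjoint U)"
  proof -
    note [simp] = c mult_carrier_mat[of _ l l _ l] assoc_mult_mat[of _ l l _ l _ l]
    show ?thesis unfolding AU B_def by simp
  qed
  also have "\<dots> = U * real_diag l d * (real_diag l (\<lambda>i. inverse (d i)) * mat_adjoint U)"
    using U by (simp add: unitary_mat_def right_mult_one_mat[OF mult_carrier_mat[OF c(1) real_diag_carrier]])
  also have "\<dots> = U * (real_diag l d * real_diag l (\<lambda>i. inverse (d i))) * mat_adjoint U"
  proof -
    note [simp] = c mult_carrier_mat[of _ l l _ l] assoc_mult_mat[of _ l l _ l _ l]
    show ?thesis by simp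
  qed
  also have "real_diag l d * real_diag l (\<lambda>i. inverse (d i)) = real_diag l (\<lambda>i. d i * inverse (d i))"
    by (simp add: real_diag_def)
  also have "\<dots> = real_diag l (\<lambda>_. 1)"
    by (rule real_diag_cong) (use d_pos in force)
  also have "real_diag l (\<lambda>_. 1) = 1\<^sub>m l" by (simp add: real_diag_def)
  finally have AB: "A * B = 1\<^sub>m l" using U c by (simp add: unitary_mat_def)
  then have BA: "B * A = 1\<^sub>m l" by (rule mat_mult_left_right_inverse[OF c(3) B])
  have "mat_inv l A = B"
    unfolding mat_inv_def
  proof (rule some_equality)
    fix B' assume B': "B' \<in> carrier_mat l l \<and> A * B' = 1\<^sub>m l \<and> B' * A = 1\<^sub>m l"
    have "B' = (B * A) * B'" using B' BA by auto
    also have "\<dots> = B * (A * B')" using B' B c by (auto simp: assoc_mult_mat[of _ l l _ l _ l])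
    finally show "B' = B" using B' B by auto
  qed (use AB BA B in auto)
  then show "hermitian_mat l (mat_inv l A)"
    using B_herm by simp
  have dl: "map d [0..<l] = rev (eigs A)"
    unfolding d_def using map_nth[of "rev (eigs A)"] len by simp
  have "sorted (rev (map (\<lambda>i. inverse (d i)) [0..<l]))"
    unfolding sorted_rev_iff_nth_mono
  proof (intro allI impI)
    fix i j assume "i \<le> j" "j < length (map (\<lambda>i. inverse (d i)) [0..<l])"
    then show "map (\<lambda>i. inverse (d i)) [0..<l] ! j \<le> map (\<lambda>i. inverse (d i)) [0..<l] ! i"
      using rev_eigs_mono[of i j A] d_pos[of i] len by (simp add: d_def)
  qed
  then have "rev (sort (map (\<lambda>i. inverse (d i)) [0..<l])) = map (\<lambda>i. inverse (d i)) [0..<l]"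
    by (metis mset_rev properties_for_sort rev_rev_ident)
  also have "\<dots> = map inverse (map d [0..<l])" by simp
  finally show "eigs (mat_inv l A) = map inverse (rev (eigs A))"
    unfolding \<open>mat_inv l A = B\<close> B_def eigs_unitary_conj[OF U] dl .
qed

section \<open>Ky Fan functionals\<close>

lemma sum_list_take_eq_sum:
  fixes xs :: "real list"
  shows "k \<le> length xs \<Longrightarrow> sum_list (take k xs) = (\<Sum>i<k. xs ! i)"
  by (simp add: sum_list_sum_nth lessThan_atLeast0)

lemma ky_fan_norm_eq_sum:
  "hermitian_mat l A \<Longrightarrow> k \<le> l \<Longrightarrow> ky_fan_norm k A = (\<Sum>i<k. eigs A ! i)"
  by (simp add: ky_fan_norm_def sum_list_take_eq_sum length_eigs)

lemma ky_fan_antinorm_eq_sum: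
  "hermitian_mat l A \<Longrightarrow> k \<le> l \<Longrightarrow> ky_fan_antinorm k A = (\<Sum>i<k. rev (eigs A) ! i)"
  by (simp add: ky_fan_antinorm_def sum_list_take_eq_sum length_eigs)

lemma psd_rev_eigs_nonneg: "psd_mat l A \<Longrightarrow> i < l \<Longrightarrow> 0 \<le> rev (eigs A) ! i"
  using psd_eigs_nonneg[of l A "l - Suc i"] length_eigs[of l A] by (simp add: rev_nth psd_mat_def)

lemma pd_rev_eigs_pos: "pd_mat l A \<Longrightarrow> i < l \<Longrightarrow> 0 < rev (eigs A) ! i"
  using pd_eigs_pos[of l A "l - Suc i"] length_eigs[of l A] by (simp add: rev_nth pd_mat_def)

text \<open>Ky Fan's minimum principle: the anti-norm is the minimum of the linear functionals
  \<open>compressed_trace k U\<close>, hence superadditive and Lipschitz in the entries.\<close>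

definition compressed_trace :: "nat \<Rightarrow> complex mat \<Rightarrow> complex mat \<Rightarrow> real" where
  "compressed_trace k U A = (\<Sum>i<k. Re ((U * A * mat_adjoint U) $$ (i, i)))"

text \<open>The squared moduli of the entries of a unitary form a doubly stochastic matrix. Adding
  its first \<open>k\<close> rows yields weights between 0 and 1 of total \<open>k\<close>, exactly
  the fractional selections treated earlier.\<close>

lemma unitary_partial_col_sums:
  assumes P: "unitary_mat l P" and k: "k \<le> l"
  shows "j < l \<Longrightarrow> (\<Sum>i<k. (cmod (P $$ (i, j)))\<^sup>2) \<le> 1"
    and "(\<Sum>j<l. \<Sum>i<k. (cmod (P $$ (i, j)))\<^sup>2) = real k"
proof -
  show "(\<Sum>i<k. (cmod (P $$ (i, j)))\<^sup>2) \<le> 1" if "j < l"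
  proof -
    have "(\<Sum>i<k. (cmod (P $$ (i, j)))\<^sup>2) \<le> (\<Sum>i<l. (cmod (P $$ (i, j)))\<^sup>2)"
      using k by (intro sum_mono2) auto
    then show ?thesis using unitary_col_norm(1)[OF P that] by simp
  qed
  have "(\<Sum>j<l. \<Sum>i<k. (cmod (P $$ (i, j)))\<^sup>2) = (\<Sum>i<k. \<Sum>j<l. (cmod (P $$ (i, j)))\<^sup>2)"
    by (rule sum.swap)
  also have "\<dots> = (\<Sum>i<k. 1)"
    using k by (intro sum.cong) (auto simp: unitary_col_norm(2)[OF P])
  finally show "(\<Sum>j<l. \<Sum>i<k. (cmod (P $$ (i, j)))\<^sup>2) = real k" by simp
qed

lemma unitary_conj_conj:
  assumes "unitary_mat l U" "unitary_mat l W"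
  shows "U * (W * real_diag l d * mat_adjoint W) * mat_adjoint U = (U * W) * real_diag l d * mat_adjoint (U * W)"
proof -
  have c: "U \<in> carrier_mat l l" "W \<in> carrier_mat l l" using assms by (auto simp: unitary_mat_def)
  show ?thesis
    unfolding mat_adjoint_mult[OF c]
    by (rule mat_sandwich_assoc) (use c mat_adjoint_carrier in auto)
qed

text \<open>In an eigenbasis of \<open>A\<close>, each diagonal entry of the conjugated matrix is an
  average of eigenvalues. Summing \<open>k\<close> of them selects eigenvalues fractionally with
  total weight \<open>k\<close>, and the cheapest such selection takes the \<open>k\<close>
  smallest.\<close>

lemma ky_fan_antinorm_le_compressed_trace:
  assumes A: "hermitian_mat l A" and U: "unitary_mat l U" and k: "k \<le> l"
  shows "ky_fan_antinorm k A \<le> compressed_trace k U A"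
proof -
  define d where "d i = rev (eigs A) ! i" for i
  obtain W where W: "unitary_mat l W" and AW: "A = W * real_diag l d * mat_adjoint W"
    unfolding d_def by (rule hermitian_spectral_rev_eigs[OF A])
  define P where "P = U * W"
  have P: "unitary_mat l P" unfolding P_def by (rule unitary_mat_mult[OF U W])
  have Pc: "P \<in> carrier_mat l l" using P by (rule unitary_mat_carrier)
  have "compressed_trace k U A = (\<Sum>i<k. Re ((P * real_diag l d * mat_adjoint P) $$ (i, i)))"
    unfolding compressed_trace_def P_def unitary_conj_conj[OF U W, symmetric] AW[symmetric] ..
  also have "\<dots> = (\<Sum>i<k. \<Sum>j<l. (cmod (P $$ (i, j)))\<^sup>2 * d j)"
  proof (rule sum.cong)
    fix i assume "i \<in> {..<k}"
    then have "i < l" using k by simp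
    show "Re ((P * real_diag l d * mat_adjoint P) $$ (i, i)) = (\<Sum>j<l. (cmod (P $$ (i, j)))\<^sup>2 * d j)"
      unfolding unitary_conj_index[OF Pc \<open>i < l\<close> \<open>i < l\<close>] Re_sum
      by (intro sum.cong refl, simp only: cmod_power2, simp add: power2_eq_square algebra_simps)
  qed simp
  also have "\<dots> = (\<Sum>j<l. (\<Sum>i<k. (cmod (P $$ (i, j)))\<^sup>2) * d j)"
    unfolding sum_distrib_right by (rule sum.swap)
  also have "\<dots> \<ge> (\<Sum>i<k. d i)"
    using rev_eigs_mono length_eigs[OF A]
    by (intro fractional_selection_ge unitary_partial_col_sums[OF P k] k) (auto simp: d_def sum_nonneg)
  finally show ?thesis by (simp add: ky_fan_antinorm_eq_sum[OF A k] d_def)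
qed

lemma ky_fan_antinorm_attained:
  assumes A: "hermitian_mat l A" and k: "k \<le> l"
  obtains U where "unitary_mat l U" and "compressed_trace k U A = ky_fan_antinorm k A"
proof -
  define d where "d i = rev (eigs A) ! i" for i
  obtain W where W: "unitary_mat l W" and AW: "A = W * real_diag l d * mat_adjoint W"
    unfolding d_def by (rule hermitian_spectral_rev_eigs[OF A])
  have Wc: "W \<in> carrier_mat l l" using W by (rule unitary_mat_carrier)
  have "mat_adjoint W * A * mat_adjoint (mat_adjoint W) = real_diag l d"
    unfolding AW mat_adjoint_adjoint[OF Wc] by (rule unitary_conj_cancel[OF W real_diag_carrier])
  then have "compressed_trace k (mat_adjoint W) A = ky_fan_antinorm k A"
    using k by (simp add: compressed_trace_def ky_fan_antinorm_eq_sum[OF A k] real_diag_index d_def)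
  with unitary_mat_adjoint[OF W] show ?thesis by (rule that)
qed

lemma unitary_entry_le_1:
  assumes U: "unitary_mat l U" and ij: "i < l" "j < l"
  shows "cmod (U $$ (i, j)) \<le> 1"
proof -
  have "(cmod (U $$ (i, j)))\<^sup>2 \<le> (\<Sum>k<l. (cmod (U $$ (i, k)))\<^sup>2)"
    using ij by (intro member_le_sum) auto
  then have "(cmod (U $$ (i, j)))\<^sup>2 \<le> 1\<^sup>2" using unitary_col_norm(2)[OF U ij(1)] by simp
  then show ?thesis by (rule power2_le_imp_le) simp
qed

text \<open>A crude bound, but uniform in \<open>U\<close> and \<open>V\<close>. It provides both
  the Lipschitz constant behind the continuity of the Ky Fan anti-norm and the finiteness of the
  supremum in \<open>variational_ky_fan_norm\<close>.\<close>

lemma unitary_triple_entry_bound: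
  assumes U: "unitary_mat l U" and V: "unitary_mat l V" and X: "X \<in> carrier_mat l l" and i: "i < l"
  shows "cmod ((U * X * V) $$ (i, i)) \<le> (\<Sum>b<l. \<Sum>a<l. cmod (X $$ (a, b)))"
proof -
  have "cmod ((U * X * V) $$ (i, i)) \<le> (\<Sum>b<l. \<Sum>a<l. cmod (U $$ (i, a) * X $$ (a, b) * V $$ (b, i)))"
    unfolding mat_triple_index[OF unitary_mat_carrier[OF U] X unitary_mat_carrier[OF V] i i]
    by (intro order_trans[OF norm_sum] sum_mono norm_sum)
  also have "\<dots> \<le> (\<Sum>b<l. \<Sum>a<l. cmod (X $$ (a, b)))"
  proof (intro sum_mono)
    fix a b assume ab: "b \<in> {..<l}" "a \<in> {..<l}"
    have "cmod (U $$ (i, a)) * cmod (X $$ (a, b)) * cmod (V $$ (b, i)) \<le> 1 * cmod (X $$ (a, b)) * 1"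
      using ab i by (intro mult_mono unitary_entry_le_1[OF U] unitary_entry_le_1[OF V]) auto
    then show "cmod (U $$ (i, a) * X $$ (a, b) * V $$ (b, i)) \<le> cmod (X $$ (a, b))"
      by (simp add: norm_mult)
  qed
  finally show ?thesis .
qed

lemma compressed_trace_linear:
  assumes U: "unitary_mat l U" and A: "A \<in> carrier_mat l l" and B: "B \<in> carrier_mat l l" and k: "k \<le> l"
  shows "compressed_trace k U (complex_of_real s \<cdot>\<^sub>m A + complex_of_real t \<cdot>\<^sub>m B) =
    s * compressed_trace k U A + t * compressed_trace k U B"
proof -
  have c: "U \<in> carrier_mat l l" "mat_adjoint U \<in> carrier_mat l l"
    using U by (auto simp: unitary_mat_def intro: mat_adjoint_carrier)
  have "(U * (complex_of_real s \<cdot>\<^sub>m A + complex_of_real t \<cdot>\<^sub>m B) * mat_adjoint U) $$ (i, i) =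
    complex_of_real s * (U * A * mat_adjoint U) $$ (i, i) +
    complex_of_real t * (U * B * mat_adjoint U) $$ (i, i)" if i: "i < l" for i
  proof -
    have C: "complex_of_real s \<cdot>\<^sub>m A + complex_of_real t \<cdot>\<^sub>m B \<in> carrier_mat l l" using A B by simp
    show ?thesis
      unfolding mat_triple_index[OF c(1) C c(2) i i] mat_triple_index[OF c(1) A c(2) i i]
        mat_triple_index[OF c(1) B c(2) i i] sum_distrib_left sum.distrib[symmetric]
      using A B by (intro sum.cong) (auto simp: algebra_simps)
  qed
  then show ?thesis
    unfolding compressed_trace_def sum_distrib_left sum.distrib[symmetric]
    using k by (intro sum.cong) auto
qed

lemma compressed_trace_diff_bound:
  assumes U: "unitary_mat l U" and A: "A \<in> carrier_mat l l" and B: "B \<in> carrier_mat l l" and k: "k \<le> l"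
  shows "compressed_trace k U A - compressed_trace k U B \<le>
    real k * (\<Sum>b<l. \<Sum>a<l. cmod (A $$ (a, b) - B $$ (a, b)))"
proof -
  let ?E = "complex_of_real 1 \<cdot>\<^sub>m A + complex_of_real (- 1) \<cdot>\<^sub>m B"
  have E: "?E \<in> carrier_mat l l" using A B by simp
  have "compressed_trace k U A - compressed_trace k U B = compressed_trace k U ?E"
    unfolding compressed_trace_linear[OF U A B k] by simp
  also have "\<dots> \<le> (\<Sum>i<k. \<Sum>b<l. \<Sum>a<l. cmod (?E $$ (a, b)))"
    unfolding compressed_trace_def
    using k by (intro sum_mono order_trans[OF complex_Re_le_cmod]
        unitary_triple_entry_bound[OF U unitary_mat_adjoint[OF U] E]) auto
  also have "\<dots> = real k * (\<Sum>b<l. \<Sum>a<l. cmod (?E $$ (a, b)))" by simp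
  also have "(\<Sum>b<l. \<Sum>a<l. cmod (?E $$ (a, b))) = (\<Sum>b<l. \<Sum>a<l. cmod (A $$ (a, b) - B $$ (a, b)))"
    using A B by (intro sum.cong) auto
  finally show ?thesis .
qed

lemma ky_fan_antinorm_diff_bound:
  assumes A: "hermitian_mat l A" and B: "hermitian_mat l B" and k: "k \<le> l"
  shows "\<bar>ky_fan_antinorm k A - ky_fan_antinorm k B\<bar> \<le>
    real k * (\<Sum>b<l. \<Sum>a<l. cmod (A $$ (a, b) - B $$ (a, b)))"
proof -
  have *: "ky_fan_antinorm k A - ky_fan_antinorm k B \<le>
      real k * (\<Sum>b<l. \<Sum>a<l. cmod (A $$ (a, b) - B $$ (a, b)))"
    if A: "hermitian_mat l A" and B: "hermitian_mat l B" for A B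
  proof -
    \<comment> \<open>A minimizer for \<open>B\<close> is a competitor for \<open>A\<close>, so the
      uniform Lipschitz bound of the traces passes to their minimum.\<close>
    obtain U where U: "unitary_mat l U" "compressed_trace k U B = ky_fan_antinorm k B"
      by (rule ky_fan_antinorm_attained[OF B k])
    have "ky_fan_antinorm k A \<le> compressed_trace k U A"
      by (rule ky_fan_antinorm_le_compressed_trace[OF A U(1) k])
    with compressed_trace_diff_bound[OF U(1) _ _ k, of A B] U A B show ?thesis
      by (simp add: hermitian_mat_def)
  qed
  from *[OF A B] *[OF B A] show ?thesis by (simp add: abs_le_iff norm_minus_commute)
qed

lemma ky_fan_antinorm_superlinear:
  assumes A: "hermitian_mat l A" and B: "hermitian_mat l B" and k: "k \<le> l" and st: "0 \<le> s" "0 \<le> t"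
  shows "s * ky_fan_antinorm k A + t * ky_fan_antinorm k B \<le>
    ky_fan_antinorm k (complex_of_real s \<cdot>\<^sub>m A + complex_of_real t \<cdot>\<^sub>m B)"
proof -
  \<comment> \<open>The minimizer for the combination is a competitor for \<open>A\<close> and for
    \<open>B\<close> separately, and the trace at this fixed unitary is linear.\<close>
  obtain U where U: "unitary_mat l U" "compressed_trace k U (complex_of_real s \<cdot>\<^sub>m A + complex_of_real t \<cdot>\<^sub>m B) =
      ky_fan_antinorm k (complex_of_real s \<cdot>\<^sub>m A + complex_of_real t \<cdot>\<^sub>m B)"
    by (rule ky_fan_antinorm_attained[OF hermitian_combination[OF A B] k])
  have "s * ky_fan_antinorm k A + t * ky_fan_antinorm k B \<le> s * compressed_trace k U A + t * compressed_trace k U B"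
    using st ky_fan_antinorm_le_compressed_trace[OF A U(1) k] ky_fan_antinorm_le_compressed_trace[OF B U(1) k]
    by (intro add_mono mult_left_mono)
  also have "\<dots> = ky_fan_antinorm k (complex_of_real s \<cdot>\<^sub>m A + complex_of_real t \<cdot>\<^sub>m B)"
    using compressed_trace_linear[OF U(1) _ _ k, of A B s t] U(2) A B by (simp add: hermitian_mat_def)
  finally show ?thesis .
qed

lemma eigs_real_smult:
  assumes A: "hermitian_mat l A" and t: "0 \<le> t"
  shows "eigs (complex_of_real t \<cdot>\<^sub>m A) = map (\<lambda>x. t * x) (eigs A)"
proof -
  obtain U where U: "unitary_mat l U" and AU: "A = U * real_diag l (\<lambda>i. eigs A ! i) * mat_adjoint U"
    by (rule hermitian_spectral_eigs[OF A])
  have c: "U \<in> carrier_mat l l" using U by (rule unitary_mat_carrier)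
  have "complex_of_real t \<cdot>\<^sub>m A = U * real_diag l (\<lambda>i. t * eigs A ! i) * mat_adjoint U"
  proof (rule eq_matI)
    fix i j assume "i < dim_row (U * real_diag l (\<lambda>i. t * eigs A ! i) * mat_adjoint U)"
      "j < dim_col (U * real_diag l (\<lambda>i. t * eigs A ! i) * mat_adjoint U)"
    then have ij: "i < l" "j < l" using c mat_adjoint_carrier[OF c] by auto
    have "A $$ (i, j) = (\<Sum>k<l. U $$ (i, k) * complex_of_real (eigs A ! k) * cnj (U $$ (j, k)))"
      by (subst AU) (rule unitary_conj_index[OF c ij])
    then show "(complex_of_real t \<cdot>\<^sub>m A) $$ (i, j) =
        (U * real_diag l (\<lambda>i. t * eigs A ! i) * mat_adjoint U) $$ (i, j)"
      unfolding unitary_conj_index[OF c ij]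
      using A ij by (auto simp: hermitian_mat_def sum_distrib_left mult_ac)
  qed (use A c mat_adjoint_carrier[OF c] in \<open>auto simp: hermitian_mat_def\<close>)
  then have "eigs (complex_of_real t \<cdot>\<^sub>m A) = rev (sort (map (\<lambda>i. t * eigs A ! i) [0..<l]))"
    by (simp only: eigs_unitary_conj[OF U])
  also have "map (\<lambda>i. t * eigs A ! i) [0..<l] = map (\<lambda>x. t * x) (eigs A)"
    by (rule nth_equalityI) (use length_eigs[OF A] in auto)
  also have "rev (sort (map (\<lambda>x. t * x) (eigs A))) = map (\<lambda>x. t * x) (eigs A)"
  proof -
    have "sorted (rev (map (\<lambda>x. t * x) (eigs A)))"
      unfolding sorted_rev_iff_nth_mono using t eigs_antimono by (auto intro!: mult_left_mono)
    then show ?thesis by (metis mset_rev properties_for_sort rev_rev_ident)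
  qed
  finally show ?thesis .
qed

lemma eigs_unitary_invariant:
  assumes A: "hermitian_mat l A" and U: "unitary_mat l U"
  shows "eigs (U * A * mat_adjoint U) = eigs A"
proof -
  obtain W d where W: "unitary_mat l W" and AW: "A = W * real_diag l d * mat_adjoint W"
    using hermitian_diagonalizable[OF A] by blast
  show ?thesis
    unfolding AW unitary_conj_conj[OF U W] eigs_unitary_conj[OF unitary_mat_mult[OF U W]]
      eigs_unitary_conj[OF W] ..
qed

lemma symmetric_antinorm_ky_fan:
  assumes k: "k \<le> l"
  shows "symmetric_antinorm l (ky_fan_antinorm k)"
  unfolding symmetric_antinorm_def
proof (intro conjI allI impI)
  have herm: "hermitian_mat l A" if "psd_mat l A" for A using that by (simp add: psd_mat_def)
  show "0 \<le> ky_fan_antinorm k A" if "psd_mat l A" for A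
    unfolding ky_fan_antinorm_eq_sum[OF herm[OF that] k]
    using psd_rev_eigs_nonneg[OF that] k by (intro sum_nonneg) auto
  show "ky_fan_antinorm k (complex_of_real t \<cdot>\<^sub>m A) = t * ky_fan_antinorm k A"
    if "psd_mat l A" "0 \<le> t" for A t
    using eigs_real_smult[OF herm[OF that(1)] that(2)]
    by (simp add: ky_fan_antinorm_def rev_map take_map sum_list_const_mult)
  show "ky_fan_antinorm k (U * A * mat_adjoint U) = ky_fan_antinorm k A"
    if "psd_mat l A" "unitary_mat l U" for A U
    using eigs_unitary_invariant[OF herm[OF that(1)] that(2)] by (simp add: ky_fan_antinorm_def)
  show "ky_fan_antinorm k A + ky_fan_antinorm k B \<le> ky_fan_antinorm k (A + B)"
    if "psd_mat l A" "psd_mat l B" for A B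
  proof -
    have "complex_of_real 1 \<cdot>\<^sub>m A + complex_of_real 1 \<cdot>\<^sub>m B = A + B"
      using herm[OF that(1)] herm[OF that(2)] by (intro eq_matI) (auto simp: hermitian_mat_def)
    then show ?thesis
      using ky_fan_antinorm_superlinear[OF herm[OF that(1)] herm[OF that(2)] k, of 1 1] by simp
  qed
  fix As A
  assume As: "\<forall>n. psd_mat l (As n)" and A: "psd_mat l A" and lim: "mat_tendsto l As A"
  have "(\<lambda>n. real k * (\<Sum>b<l. \<Sum>a<l. cmod (As n $$ (a, b) - A $$ (a, b)))) \<longlonglongrightarrow>
      real k * (\<Sum>b<l. \<Sum>a<l. cmod (A $$ (a, b) - A $$ (a, b)))"
    using lim by (intro tendsto_intros) (auto simp: mat_tendsto_def)
  then have bound_lim: "(\<lambda>n. real k * (\<Sum>b<l. \<Sum>a<l. cmod (As n $$ (a, b) - A $$ (a, b)))) \<longlonglongrightarrow> 0" by simp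
  have "(\<lambda>n. \<bar>ky_fan_antinorm k (As n) - ky_fan_antinorm k A\<bar>) \<longlonglongrightarrow> 0"
    by (rule tendsto_sandwich[OF _ _ tendsto_const bound_lim])
      (use ky_fan_antinorm_diff_bound[OF herm herm k] As A in auto)
  then have "(\<lambda>n. ky_fan_antinorm k (As n) - ky_fan_antinorm k A) \<longlonglongrightarrow> 0"
    by (rule tendsto_rabs_zero_cancel)
  then show "(\<lambda>n. ky_fan_antinorm k (As n)) \<longlonglongrightarrow> ky_fan_antinorm k A"
    by (rule LIM_zero_cancel)
qed

text \<open>The Ky Fan norm of arbitrary matrices, by its variational characterization; it avoids
  singular values, and agrees with the sum of the largest eigenvalues on positive semidefinite
  matrices.\<close>

definition variational_ky_fan_norm :: "nat \<Rightarrow> nat \<Rightarrow> complex mat \<Rightarrow> real" where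
  "variational_ky_fan_norm l k X =
    Sup {(\<Sum>i<k. cmod ((U * X * V) $$ (i, i))) | U V. unitary_mat l U \<and> unitary_mat l V}"

lemma variational_ky_fan_norm_upper:
  assumes X: "X \<in> carrier_mat l l" and k: "k \<le> l" and "unitary_mat l U" "unitary_mat l V"
  shows "(\<Sum>i<k. cmod ((U * X * V) $$ (i, i))) \<le> variational_ky_fan_norm l k X"
  unfolding variational_ky_fan_norm_def
proof (rule cSup_upper)
  show "bdd_above {(\<Sum>i<k. cmod ((U * X * V) $$ (i, i))) | U V. unitary_mat l U \<and> unitary_mat l V}"
  proof (rule bdd_aboveI)
    fix y assume "y \<in> {(\<Sum>i<k. cmod ((U * X * V) $$ (i, i))) | U V. unitary_mat l U \<and> unitary_mat l V}"
    then obtain U V where UV: "unitary_mat l U" "unitary_mat l V"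
      and y: "y = (\<Sum>i<k. cmod ((U * X * V) $$ (i, i)))" by blast
    show "y \<le> (\<Sum>i<k. \<Sum>b<l. \<Sum>a<l. cmod (X $$ (a, b)))"
      unfolding y using k by (intro sum_mono unitary_triple_entry_bound[OF UV X]) auto
  qed
qed (use assms in blast)

lemma variational_ky_fan_norm_least:
  assumes "\<And>U V. unitary_mat l U \<Longrightarrow> unitary_mat l V \<Longrightarrow> (\<Sum>i<k. cmod ((U * X * V) $$ (i, i))) \<le> c"
  shows "variational_ky_fan_norm l k X \<le> c"
  unfolding variational_ky_fan_norm_def
  by (rule cSup_least) (use assms unitary_mat_one in blast)+

lemma variational_ky_fan_norm_smult_le:
  assumes X: "X \<in> carrier_mat l l" and k: "k \<le> l"
  shows "variational_ky_fan_norm l k (c \<cdot>\<^sub>m X) \<le> cmod c * variational_ky_fan_norm l k X"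
proof (rule variational_ky_fan_norm_least)
  fix U V assume UV: "unitary_mat l U" "unitary_mat l V"
  then have c: "U \<in> carrier_mat l l" "V \<in> carrier_mat l l" by (auto simp: unitary_mat_def)
  have "U * (c \<cdot>\<^sub>m X) * V = c \<cdot>\<^sub>m (U * X * V)"
    using c X by (simp add: mult_smult_distrib[of _ l l _ l] mult_smult_assoc_mat[of _ l l _ l])
  then have "(\<Sum>i<k. cmod ((U * (c \<cdot>\<^sub>m X) * V) $$ (i, i))) = cmod c * (\<Sum>i<k. cmod ((U * X * V) $$ (i, i)))"
    unfolding sum_distrib_left using c X k by (intro sum.cong) (auto simp: norm_mult simp del: index_mult_mat(1))
  also have "\<dots> \<le> cmod c * variational_ky_fan_norm l k X"
    by (intro mult_left_mono variational_ky_fan_norm_upper X k UV) simp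
  finally show "(\<Sum>i<k. cmod ((U * (c \<cdot>\<^sub>m X) * V) $$ (i, i))) \<le> cmod c * variational_ky_fan_norm l k X" .
qed

lemma symmetric_norm_variational_ky_fan:
  assumes k: "1 \<le> k" "k \<le> l"
  shows "symmetric_norm l (variational_ky_fan_norm l k)"
  unfolding symmetric_norm_def
proof (intro conjI ballI allI impI)
  let ?N = "variational_ky_fan_norm l k"
  note upper = variational_ky_fan_norm_upper[OF _ k(2)]
  fix X :: "complex mat" assume X: "X \<in> carrier_mat l l"
  have "0 \<le> (\<Sum>i<k. cmod ((1\<^sub>m l * X * 1\<^sub>m l) $$ (i, i)))" by (intro sum_nonneg) simp
  also have "\<dots> \<le> ?N X" by (rule upper[OF X unitary_mat_one unitary_mat_one])
  finally show "0 \<le> ?N X" .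
  show "X = 0\<^sub>m l l" if zero: "?N X = 0"
  proof (rule eq_matI)
    fix a b assume "a < dim_row (0\<^sub>m l l :: complex mat)" "b < dim_col (0\<^sub>m l l :: complex mat)"
    then have ab: "a < l" "b < l" by auto
    have l: "0 < l" using k by simp
    have ne: "unit_vec l i \<noteq> (0\<^sub>v l :: complex vec)" if "i < l" for i
      using that by (metis index_unit_vec(1) index_zero_vec(1) zero_neq_one)
    \<comment> \<open>Unitaries whose first columns point along the unit vectors \<open>a\<close>
      and \<open>b\<close> move the entry \<open>(a, b)\<close> to the corner, up to nonzero
      factors. As \<open>k\<close> is at least 1, the corner is among the entries bounded by the
      norm.\<close>
    obtain W c where W: "unitary_mat l W" and Wcol: "col W 0 = c \<cdot>\<^sub>v unit_vec l a"
      by (rule unitary_completion[OF _ ne[OF ab(1)] l]) auto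
    obtain V c' where V: "unitary_mat l V" and Vcol: "col V 0 = c' \<cdot>\<^sub>v unit_vec l b"
      by (rule unitary_completion[OF _ ne[OF ab(2)] l]) auto
    have car: "W \<in> carrier_mat l l" "V \<in> carrier_mat l l" "mat_adjoint W \<in> carrier_mat l l"
      using W V by (auto simp: unitary_mat_def intro: mat_adjoint_carrier)
    have W0: "W $$ (i, 0) = (if i = a then c else 0)" if "i < l" for i
      using arg_cong[OF Wcol, of "\<lambda>v. v $ i"] that car l ab by auto
    have V0: "V $$ (i, 0) = (if i = b then c' else 0)" if "i < l" for i
      using arg_cong[OF Vcol, of "\<lambda>v. v $ i"] that car l ab by auto
    have "c \<noteq> 0"
      using unitary_col_norm(1)[OF W l] by (auto simp: W0)
    moreover have "c' \<noteq> 0"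
      using unitary_col_norm(1)[OF V l] by (auto simp: V0)
    moreover have "(mat_adjoint W * X * V) $$ (0, 0) = cnj c * X $$ (a, b) * c'"
    proof -
      have "(mat_adjoint W * X * V) $$ (0, 0) =
          (\<Sum>j<l. \<Sum>i<l. if j = b then if i = a then cnj c * X $$ (a, b) * c' else 0 else 0)"
        unfolding mat_triple_index[OF car(3) X car(2) l l]
        by (intro sum.cong) (auto simp: mat_adjoint_index[OF car(1)] W0 V0 l)
      also have "\<dots> = (\<Sum>j<l. if j = b then cnj c * X $$ (a, b) * c' else 0)"
        using ab by (intro sum.cong) auto
      finally show ?thesis using ab by simp
    qed
    moreover have "cmod ((mat_adjoint W * X * V) $$ (0, 0)) \<le> 0"
    proof -
      have "cmod ((mat_adjoint W * X * V) $$ (0, 0)) \<le> (\<Sum>i<k. cmod ((mat_adjoint W * X * V) $$ (i, i)))"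
        using k by (intro member_le_sum) auto
      also have "\<dots> \<le> 0"
        using upper[OF X unitary_mat_adjoint[OF W] V] zero by simp
      finally show ?thesis .
    qed
    ultimately show "X $$ (a, b) = 0\<^sub>m l l $$ (a, b)" using ab by simp
  qed (use X in auto)
  show "?N (c \<cdot>\<^sub>m X) = cmod c * ?N X" for c
  proof (rule antisym)
    show "?N (c \<cdot>\<^sub>m X) \<le> cmod c * ?N X" by (rule variational_ky_fan_norm_smult_le[OF X k(2)])
    show "cmod c * ?N X \<le> ?N (c \<cdot>\<^sub>m X)"
    proof (cases "c = 0")
      case True
      have "0 \<le> (\<Sum>i<k. cmod ((1\<^sub>m l * (c \<cdot>\<^sub>m X) * 1\<^sub>m l) $$ (i, i)))" by (intro sum_nonneg) simp
      also have "\<dots> \<le> ?N (c \<cdot>\<^sub>m X)"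
        using X by (intro upper unitary_mat_one) simp
      finally show ?thesis using True by simp
    next
      case False
      \<comment> \<open>Homogeneity needs only the upper estimate: applied to
        \<open>c \<cdot>\<^sub>m X\<close> with factor \<open>inverse c\<close>, it gives the
        opposite one.\<close>
      have "inverse c \<cdot>\<^sub>m (c \<cdot>\<^sub>m X) = X"
        using False by (intro eq_matI) auto
      then have "?N X \<le> cmod (inverse c) * ?N (c \<cdot>\<^sub>m X)"
        using variational_ky_fan_norm_smult_le[of "c \<cdot>\<^sub>m X" l k "inverse c"] X k by simp
      with False show ?thesis by (simp add: norm_divide field_simps)
    qed
  qed
  show "?N (X + Y) \<le> ?N X + ?N Y" if Y: "Y \<in> carrier_mat l l" for Y
  proof (rule variational_ky_fan_norm_least)
    fix U V assume UV: "unitary_mat l U" "unitary_mat l V"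
    then have c: "U \<in> carrier_mat l l" "V \<in> carrier_mat l l" by (auto simp: unitary_mat_def)
    have "U * (X + Y) * V = U * X * V + U * Y * V"
      using c X Y by (simp add: mult_add_distrib_mat[of _ l l _ l] add_mult_distrib_mat[of _ l l _ _ l])
    then have "(\<Sum>i<k. cmod ((U * (X + Y) * V) $$ (i, i))) =
        (\<Sum>i<k. cmod ((U * X * V) $$ (i, i) + (U * Y * V) $$ (i, i)))"
      using c X Y k by (intro sum.cong) (auto simp del: index_mult_mat(1))
    also have "\<dots> \<le> (\<Sum>i<k. cmod ((U * X * V) $$ (i, i))) + (\<Sum>i<k. cmod ((U * Y * V) $$ (i, i)))"
      unfolding sum.distrib[symmetric] by (intro sum_mono norm_triangle_ineq)
    also have "\<dots> \<le> ?N X + ?N Y" by (intro add_mono upper X Y UV)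
    finally show "(\<Sum>i<k. cmod ((U * (X + Y) * V) $$ (i, i))) \<le> ?N X + ?N Y" .
  qed
  \<comment> \<open>Multiplication on the group of unitaries only moves competitors of the supremum
    around. Stated for arbitrary \<open>X\<close>, this inequality is used again with the adjoints
    to undo the transformation.\<close>
  have le: "?N (U * X * V) \<le> ?N X" if X: "X \<in> carrier_mat l l" and UV: "unitary_mat l U" "unitary_mat l V" for X U V
  proof (rule variational_ky_fan_norm_least)
    fix U' V' assume UV': "unitary_mat l U'" "unitary_mat l V'"
    have "U' * (U * X * V) * V' = (U' * U) * X * (V * V')"
      by (rule mat_sandwich_assoc) (use UV UV' X in \<open>auto simp: unitary_mat_def\<close>)
    then show "(\<Sum>i<k. cmod ((U' * (U * X * V) * V') $$ (i, i))) \<le> ?N X"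
      using upper[OF X unitary_mat_mult[OF UV'(1) UV(1)] unitary_mat_mult[OF UV(2) UV'(2)]] by simp
  qed
  show "?N (U * X * V) = ?N X" if UV: "unitary_mat l U" "unitary_mat l V" for U V
  proof (rule antisym)
    show "?N (U * X * V) \<le> ?N X" by (rule le[OF X UV])
    have c: "U \<in> carrier_mat l l" "V \<in> carrier_mat l l"
      "mat_adjoint U \<in> carrier_mat l l" "mat_adjoint V \<in> carrier_mat l l"
      using UV by (auto simp: unitary_mat_def intro: mat_adjoint_carrier)
    have "mat_adjoint U * (U * X * V) * mat_adjoint V = (mat_adjoint U * U) * X * (V * mat_adjoint V)"
      by (rule mat_sandwich_assoc) (use c X in auto)
    also have "\<dots> = X" using UV X by (simp add: unitary_mat_def)
    finally have "mat_adjoint U * (U * X * V) * mat_adjoint V = X" .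
    moreover have "?N (mat_adjoint U * (U * X * V) * mat_adjoint V) \<le> ?N (U * X * V)"
      using c X by (intro le unitary_mat_adjoint UV mult_carrier_mat[of _ l l])
    ultimately show "?N X \<le> ?N (U * X * V)" by simp
  qed
qed

lemma variational_ky_fan_norm_eq:
  assumes A: "hermitian_mat l A" and nonneg: "\<And>i. i < l \<Longrightarrow> 0 \<le> eigs A ! i" and k: "k \<le> l"
  shows "variational_ky_fan_norm l k A = ky_fan_norm k A"
proof -
  define d where "d i = eigs A ! i" for i
  obtain W where W: "unitary_mat l W" and AW: "A = W * real_diag l d * mat_adjoint W"
    unfolding d_def by (rule hermitian_spectral_eigs[OF A])
  have Wc: "W \<in> carrier_mat l l" "mat_adjoint W \<in> carrier_mat l l"
    using W by (auto simp: unitary_mat_def intro: mat_adjoint_carrier)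
  have sum_d: "ky_fan_norm k A = (\<Sum>i<k. d i)" by (simp add: ky_fan_norm_eq_sum[OF A k] d_def)
  show ?thesis
  proof (rule antisym)
    have Ac: "A \<in> carrier_mat l l" using A by (simp add: hermitian_mat_def)
    have "mat_adjoint W * A * W = real_diag l d"
      unfolding AW by (rule unitary_conj_cancel[OF W real_diag_carrier])
    then have "(\<Sum>i<k. cmod ((mat_adjoint W * A * W) $$ (i, i))) = (\<Sum>i<k. d i)"
      using k nonneg by (intro sum.cong) (auto simp: real_diag_index d_def)
    then show "ky_fan_norm k A \<le> variational_ky_fan_norm l k A"
      using variational_ky_fan_norm_upper[OF Ac k unitary_mat_adjoint[OF W] W] by (simp add: sum_d)
  next
    show "variational_ky_fan_norm l k A \<le> ky_fan_norm k A"
    proof (rule variational_ky_fan_norm_least)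
      fix U V assume UV: "unitary_mat l U" "unitary_mat l V"
      define P where "P = U * W"
      \<comment> \<open>The adjoint is taken so that \<open>U * A * V\<close> becomes
        \<open>P * real_diag l d * mat_adjoint Q\<close>, with \<open>P\<close> and \<open>Q\<close>
        entering its diagonal entries in the same way.\<close>
      define Q where "Q = mat_adjoint (mat_adjoint W * V)"
      have P: "unitary_mat l P" unfolding P_def by (rule unitary_mat_mult[OF UV(1) W])
      have Q: "unitary_mat l Q" unfolding Q_def
        by (intro unitary_mat_adjoint unitary_mat_mult UV W)
      have c: "P \<in> carrier_mat l l" "Q \<in> carrier_mat l l" "mat_adjoint Q \<in> carrier_mat l l"
        using P Q by (auto simp: unitary_mat_def intro: mat_adjoint_carrier)
      have WV: "mat_adjoint W * V \<in> carrier_mat l l" using Wc UV by (auto simp: unitary_mat_def)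
      have UAV: "U * A * V = P * real_diag l d * mat_adjoint Q"
        unfolding AW P_def Q_def mat_adjoint_adjoint[OF WV]
        by (rule mat_sandwich_assoc) (use Wc UV in \<open>auto simp: unitary_mat_def\<close>)
      \<comment> \<open>The product of the moduli of the entries of \<open>P\<close> and
        \<open>Q\<close> is at most the mean of their squares. The resulting weights
        \<open>q\<close> average two fractional selections, hence form one themselves.\<close>
      define q where "q j = (\<Sum>i<k. ((cmod (P $$ (i, j)))\<^sup>2 + (cmod (Q $$ (i, j)))\<^sup>2) / 2)" for j
      have q_eq: "q j = ((\<Sum>i<k. (cmod (P $$ (i, j)))\<^sup>2) + (\<Sum>i<k. (cmod (Q $$ (i, j)))\<^sup>2)) / 2" for j
        unfolding q_def by (simp add: sum_divide_distrib sum.distrib add_divide_distrib)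
      have q1: "q j \<le> 1" if "j < l" for j
        using unitary_partial_col_sums(1)[OF P k that] unitary_partial_col_sums(1)[OF Q k that]
        by (simp add: q_eq)
      have q2: "(\<Sum>j<l. q j) \<le> real k"
        using unitary_partial_col_sums(2)[OF P k] unitary_partial_col_sums(2)[OF Q k]
        unfolding q_eq sum_divide_distrib[symmetric] sum.distrib by simp
      have "(\<Sum>i<k. cmod ((U * A * V) $$ (i, i))) \<le>
          (\<Sum>i<k. \<Sum>j<l. ((cmod (P $$ (i, j)))\<^sup>2 + (cmod (Q $$ (i, j)))\<^sup>2) / 2 * d j)"
      proof (rule sum_mono)
        fix i assume "i \<in> {..<k}"
        then have i: "i < l" using k by simp
        have "cmod ((U * A * V) $$ (i, i)) \<le>
            (\<Sum>j<l. cmod (P $$ (i, j) * complex_of_real (d j) * mat_adjoint Q $$ (j, i)))"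
          unfolding UAV real_diag_triple_index[OF c(1,3) i i] by (rule norm_sum)
        also have "\<dots> \<le> (\<Sum>j<l. ((cmod (P $$ (i, j)))\<^sup>2 + (cmod (Q $$ (i, j)))\<^sup>2) / 2 * d j)"
        proof (rule sum_mono)
          fix j assume "j \<in> {..<l}"
          then have j: "j < l" by simp
          have "cmod (P $$ (i, j)) * cmod (Q $$ (i, j)) \<le> ((cmod (P $$ (i, j)))\<^sup>2 + (cmod (Q $$ (i, j)))\<^sup>2) / 2"
            using sum_squares_bound[of "cmod (P $$ (i, j))" "cmod (Q $$ (i, j))"] by simp
          then have "cmod (P $$ (i, j)) * cmod (Q $$ (i, j)) * d j \<le>
              ((cmod (P $$ (i, j)))\<^sup>2 + (cmod (Q $$ (i, j)))\<^sup>2) / 2 * d j"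
            by (rule mult_right_mono) (simp add: d_def nonneg j)
          then show "cmod (P $$ (i, j) * complex_of_real (d j) * mat_adjoint Q $$ (j, i)) \<le>
              ((cmod (P $$ (i, j)))\<^sup>2 + (cmod (Q $$ (i, j)))\<^sup>2) / 2 * d j"
            using nonneg[OF j] by (simp add: norm_mult mat_adjoint_index[OF c(2) j i] d_def mult_ac)
        qed
        finally show "cmod ((U * A * V) $$ (i, i)) \<le>
          (\<Sum>j<l. ((cmod (P $$ (i, j)))\<^sup>2 + (cmod (Q $$ (i, j)))\<^sup>2) / 2 * d j)" .
      qed
      also have "\<dots> = (\<Sum>j<l. q j * d j)"
        unfolding q_def sum_distrib_right by (rule sum.swap)
      also have "\<dots> \<le> (\<Sum>i<k. d i)"
      proof (rule fractional_selection_le[OF _ _ _ q1 q2 k])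
        show "0 \<le> q i" for i unfolding q_def by (intro sum_nonneg) simp
      qed (use eigs_antimono length_eigs[OF A] nonneg in \<open>auto simp: d_def\<close>)
      finally show "(\<Sum>i<k. cmod ((U * A * V) $$ (i, i))) \<le> ky_fan_norm k A" by (simp add: sum_d)
    qed
  qed
qed

section \<open>Symmetric norms and anti-norms under weak majorization\<close>

lemma real_diag_combination:
  "complex_of_real s \<cdot>\<^sub>m real_diag l x + complex_of_real t \<cdot>\<^sub>m real_diag l y = real_diag l (\<lambda>i. s * x i + t * y i)"
  by (rule eq_matI) (auto simp: real_diag_def mat_diag_def)

text \<open>Swapping two entries keeps the multiset of eigenvalues, so the spectral theorem with
  prescribed diagonal supplies the unitary.\<close>

lemma real_diag_transpose:
  assumes "i < l" "j < l"
  obtains U where "unitary_mat l U"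
    and "real_diag l (\<lambda>k. d (transpose i j k)) = U * real_diag l d * mat_adjoint U"
proof -
  have p: "transpose i j permutes {..<l}" using assms by (intro permutes_swap_id) auto
  have "eigs (real_diag l (\<lambda>k. d (transpose i j k))) = rev (sort (map (\<lambda>k. d (transpose i j k)) [0..<l]))"
    using eigs_unitary_conj[OF unitary_mat_one, of l] by (simp only: real_diag_conj_one)
  moreover have "mset (map (\<lambda>k. d (transpose i j k)) [0..<l]) = mset (map d [0..<l])"
  proof -
    have "mset (map (transpose i j) [0..<l]) = mset [0..<l]"
      using permutes_image[OF p] permutes_inj_on[OF p]
      by (subst set_eq_iff_mset_eq_distinct[symmetric]) (auto simp: distinct_map lessThan_atLeast0)
    then have "image_mset d (mset (map (transpose i j) [0..<l])) = image_mset d (mset [0..<l])" by simp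
    then show ?thesis by (simp only: mset_map[symmetric] map_map o_def)
  qed
  ultimately have "mset (map d [0..<l]) = mset (eigs (real_diag l (\<lambda>k. d (transpose i j k))))" by simp
  from hermitian_spectral[OF hermitian_real_diag this] show ?thesis using that by blast
qed

lemma symmetric_normD:
  assumes "symmetric_norm l N"
  shows "X \<in> carrier_mat l l \<Longrightarrow> N (c \<cdot>\<^sub>m X) = cmod c * N X"
    and "X \<in> carrier_mat l l \<Longrightarrow> Y \<in> carrier_mat l l \<Longrightarrow> N (X + Y) \<le> N X + N Y"
    and "X \<in> carrier_mat l l \<Longrightarrow> unitary_mat l U \<Longrightarrow> unitary_mat l V \<Longrightarrow> N (U * X * V) = N X"
  using assms by (auto simp: symmetric_norm_def)

lemma symmetric_antinormD:
  assumes "symmetric_antinorm l N"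
  shows "psd_mat l A \<Longrightarrow> 0 \<le> N A"
    and "psd_mat l A \<Longrightarrow> 0 \<le> t \<Longrightarrow> N (complex_of_real t \<cdot>\<^sub>m A) = t * N A"
    and "psd_mat l A \<Longrightarrow> unitary_mat l U \<Longrightarrow> N (U * A * mat_adjoint U) = N A"
    and "psd_mat l A \<Longrightarrow> psd_mat l B \<Longrightarrow> N A + N B \<le> N (A + B)"
  using assms by (auto simp: symmetric_antinorm_def)

lemma symmetric_norm_diag_convex:
  assumes N: "symmetric_norm l N" and st: "0 \<le> s" "0 \<le> t"
  shows "N (real_diag l (\<lambda>i. s * x i + t * y i)) \<le> s * N (real_diag l x) + t * N (real_diag l y)"
proof -
  have "N (real_diag l (\<lambda>i. s * x i + t * y i)) \<le>
      N (complex_of_real s \<cdot>\<^sub>m real_diag l x) + N (complex_of_real t \<cdot>\<^sub>m real_diag l y)"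
    unfolding real_diag_combination[symmetric] by (intro symmetric_normD(2)[OF N]) auto
  then show ?thesis using st by (simp add: symmetric_normD(1)[OF N])
qed

lemma symmetric_antinorm_diag_concave:
  assumes N: "symmetric_antinorm l N" and st: "0 \<le> s" "0 \<le> t"
    and xy: "\<And>i. i < l \<Longrightarrow> 0 \<le> x i" "\<And>i. i < l \<Longrightarrow> 0 \<le> y i"
  shows "s * N (real_diag l x) + t * N (real_diag l y) \<le> N (real_diag l (\<lambda>i. s * x i + t * y i))"
proof -
  have smult: "complex_of_real r \<cdot>\<^sub>m real_diag l z = real_diag l (\<lambda>i. r * z i)" for r z
    by (rule eq_matI) (auto simp: real_diag_def mat_diag_def)
  have "N (complex_of_real s \<cdot>\<^sub>m real_diag l x) + N (complex_of_real t \<cdot>\<^sub>m real_diag l y) \<le>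
      N (real_diag l (\<lambda>i. s * x i + t * y i))"
    unfolding real_diag_combination[symmetric]
    by (intro symmetric_antinormD(4)[OF N]) (auto simp: smult intro!: psd_real_diag mult_nonneg_nonneg st xy)
  then show ?thesis
    using st xy by (simp add: symmetric_antinormD(2)[OF N] psd_real_diag)
qed

text \<open>A diagonal matrix of signs is multiplied on one side only. Conjugation by it would
  cancel the sign, so this uses that a symmetric norm admits independent unitaries on the left and
  on the right.\<close>

lemma symmetric_norm_diag_sign:
  assumes N: "symmetric_norm l N"
  shows "N (real_diag l (u(k := - u k))) = N (real_diag l u)"
proof -
  define \<sigma> :: "nat \<Rightarrow> real" where "\<sigma> i = (if i = k then - 1 else 1)" for i
  have prod: "real_diag l x * real_diag l y = real_diag l (\<lambda>i. x i * y i)" for x y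
    by (simp add: real_diag_def)
  have one: "real_diag l (\<lambda>_. 1) = 1\<^sub>m l" by (simp add: real_diag_def)
  have "mat_adjoint (real_diag l \<sigma>) = real_diag l \<sigma>"
    using hermitian_real_diag by (simp add: hermitian_mat_def)
  moreover have "(\<lambda>i. \<sigma> i * \<sigma> i) = (\<lambda>_. 1)" by (auto simp: \<sigma>_def)
  ultimately have "unitary_mat l (real_diag l \<sigma>)"
    by (simp add: unitary_mat_def prod one)
  then have "N (real_diag l \<sigma> * real_diag l u * 1\<^sub>m l) = N (real_diag l u)"
    by (intro symmetric_normD(3)[OF N] unitary_mat_one) auto
  moreover have "(\<lambda>i. \<sigma> i * u i) = u(k := - u k)" by (auto simp: \<sigma>_def)
  ultimately show ?thesis by (simp add: prod right_mult_one_mat[OF real_diag_carrier])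
qed

text \<open>Shrinking one nonnegative entry is a convex combination with its sign change.\<close>

lemma symmetric_norm_diag_mono:
  assumes N: "symmetric_norm l N" and x: "\<And>i. i < l \<Longrightarrow> 0 \<le> x i" "\<And>i. i < l \<Longrightarrow> x i \<le> w i"
  shows "N (real_diag l x) \<le> N (real_diag l w)"
proof -
  \<comment> \<open>Entries are shrunk one at a time, passing through vectors that agree with
    \<open>x\<close> below \<open>k\<close> and with \<open>w\<close> from there on.\<close>
  have "N (real_diag l (\<lambda>i. if i < k then x i else w i)) \<le> N (real_diag l w)" if "k \<le> l" for k
    using that
  proof (induction k)
    case (Suc k)
    define u where "u i = (if i < k then x i else w i)" for i
    \<comment> \<open>This solves \<open>(1 - 2 * \<theta>) * w k = x k\<close>. If
      \<open>w k = 0\<close>, then \<open>x k = 0\<close> too, and division by zero yields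
      \<open>\<theta> = 1 / 2\<close>, which is still a valid weight.\<close>
    define \<theta> where "\<theta> = (1 - x k / w k) / 2"
    have xk: "0 \<le> x k" "x k \<le> w k" using x Suc.prems by auto
    have \<theta>: "0 \<le> 1 - \<theta>" "0 \<le> \<theta>" using xk by (auto simp: \<theta>_def divide_simps)
    have "(1 - \<theta>) * w k + \<theta> * (- w k) = x k"
      using xk by (cases "w k = 0") (auto simp: \<theta>_def field_simps)
    then have "(\<lambda>i. if i < Suc k then x i else w i) = (\<lambda>i. (1 - \<theta>) * u i + \<theta> * (u(k := - u k)) i)"
      by (auto simp: u_def fun_eq_iff less_Suc_eq algebra_simps)
    then have "N (real_diag l (\<lambda>i. if i < Suc k then x i else w i)) \<le>
        (1 - \<theta>) * N (real_diag l u) + \<theta> * N (real_diag l (u(k := - u k)))"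
      using symmetric_norm_diag_convex[OF N \<theta>, of u "u(k := - u k)"] by (simp only:)
    also have "\<dots> = N (real_diag l u)"
      unfolding symmetric_norm_diag_sign[OF N] by (simp add: algebra_simps)
    also have "\<dots> \<le> N (real_diag l w)" unfolding u_def using Suc by simp
    finally show ?case .
  qed simp
  from this[of l] show ?thesis
    using real_diag_cong[of l "\<lambda>i. if i < l then x i else w i" x] by simp
qed

lemma symmetric_norm_weak_majorization:
  assumes N: "symmetric_norm l N"
    and x: "\<And>i j. i \<le> j \<Longrightarrow> j < l \<Longrightarrow> x j \<le> x i" "\<And>i. i < l \<Longrightarrow> 0 \<le> x i"
    and maj: "\<And>k. k \<le> l \<Longrightarrow> (\<Sum>i<k. x i) \<le> (\<Sum>i<k. w i)"
  shows "N (real_diag l x) \<le> N (real_diag l w)"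
proof -
  \<comment> \<open>The comparison is with the fixed vector \<open>w\<close>, so an averaging has
    only to not increase the norm: the swapped vector has the same norm, and convexity does the
    rest.\<close>
  define P where "P u \<longleftrightarrow> N (real_diag l u) \<le> N (real_diag l w)" for u
  have "P x"
  proof (rule weak_majorization_induct[of l x w P])
    fix u i j and \<theta> :: real
    assume u: "P u" and ij: "i < l" "j < l" and \<theta>: "0 \<le> \<theta>" "\<theta> \<le> 1"
    obtain U where U: "unitary_mat l U"
      and UU: "real_diag l (\<lambda>k. u (transpose i j k)) = U * real_diag l u * mat_adjoint U"
      by (rule real_diag_transpose[OF ij])
    have eq: "N (real_diag l (\<lambda>k. u (transpose i j k))) = N (real_diag l u)"
      unfolding UU by (intro symmetric_normD(3)[OF N] U unitary_mat_adjoint) simp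
    have "N (real_diag l (\<lambda>k. (1 - \<theta>) * u k + \<theta> * u (transpose i j k))) \<le>
        (1 - \<theta>) * N (real_diag l u) + \<theta> * N (real_diag l (\<lambda>k. u (transpose i j k)))"
      using \<theta> by (intro symmetric_norm_diag_convex[OF N]) auto
    also have "\<dots> = N (real_diag l u)" unfolding eq by (simp add: algebra_simps)
    finally show "P (\<lambda>k. (1 - \<theta>) * u k + \<theta> * u (transpose i j k))"
      using u by (simp add: P_def)
  next
    fix u assume "P u" "\<And>i. i < l \<Longrightarrow> x i \<le> u i"
    then show "P x" using symmetric_norm_diag_mono[OF N, of x u] x(2) by (simp add: P_def)
  qed (use x maj in \<open>auto simp: P_def\<close>)
  then show ?thesis by (simp add: P_def)
qed

lemma symmetric_antinorm_weak_majorization: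
  assumes N: "symmetric_antinorm l N"
    and x: "\<And>i j. i \<le> j \<Longrightarrow> j < l \<Longrightarrow> x i \<le> x j"
    and w: "\<And>i. i < l \<Longrightarrow> 0 \<le> w i"
    and maj: "\<And>k. k \<le> l \<Longrightarrow> (\<Sum>i<k. w i) \<le> (\<Sum>i<k. x i)"
  shows "N (real_diag l w) \<le> N (real_diag l x)"
proof -
  \<comment> \<open>Negation turns the increasing order into the decreasing one required by the
    induction. The sign condition travels along because an anti-norm is controlled on positive
    semidefinite matrices only.\<close>
  define P where "P u \<longleftrightarrow> (\<forall>i<l. u i \<le> 0) \<and> N (real_diag l w) \<le> N (real_diag l (\<lambda>i. - u i))" for u
  have "P (\<lambda>i. - x i)"
  proof (rule weak_majorization_induct[of l "\<lambda>i. - x i" "\<lambda>i. - w i" P])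
    fix u i j and \<theta> :: real
    assume u: "P u" and ij: "i < l" "j < l" and \<theta>: "0 \<le> \<theta>" "\<theta> \<le> 1"
    define v where "v k = - u k" for k
    have v: "0 \<le> v k" "0 \<le> v (transpose i j k)" if "k < l" for k
      using u ij that by (auto simp: P_def v_def transpose_def)
    obtain U where U: "unitary_mat l U"
      and UU: "real_diag l (\<lambda>k. v (transpose i j k)) = U * real_diag l v * mat_adjoint U"
      by (rule real_diag_transpose[OF ij])
    have eq: "N (real_diag l (\<lambda>k. v (transpose i j k))) = N (real_diag l v)"
      unfolding UU by (intro symmetric_antinormD(3)[OF N] U psd_real_diag v)
    have "N (real_diag l v) = (1 - \<theta>) * N (real_diag l v) + \<theta> * N (real_diag l (\<lambda>k. v (transpose i j k)))"
      unfolding eq by (simp add: algebra_simps)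
    also have "\<dots> \<le> N (real_diag l (\<lambda>k. (1 - \<theta>) * v k + \<theta> * v (transpose i j k)))"
      using \<theta> v by (intro symmetric_antinorm_diag_concave[OF N]) auto
    also have "(\<lambda>k. (1 - \<theta>) * v k + \<theta> * v (transpose i j k)) = (\<lambda>k. - ((1 - \<theta>) * u k + \<theta> * u (transpose i j k)))"
      by (auto simp: v_def)
    finally have "N (real_diag l v) \<le> N (real_diag l (\<lambda>k. - ((1 - \<theta>) * u k + \<theta> * u (transpose i j k))))" .
    moreover have "N (real_diag l w) \<le> N (real_diag l v)" using u by (simp add: P_def v_def[abs_def])
    moreover have "(1 - \<theta>) * u k + \<theta> * u (transpose i j k) \<le> 0" if "k < l" for k
    proof -
      have "0 \<le> (1 - \<theta>) * v k + \<theta> * v (transpose i j k)"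
        using v[OF that] \<theta> by (intro add_nonneg_nonneg mult_nonneg_nonneg) auto
      then show ?thesis by (simp add: v_def)
    qed
    ultimately show "P (\<lambda>k. (1 - \<theta>) * u k + \<theta> * u (transpose i j k))"
      by (auto simp: P_def)
  next
    fix u assume u: "P u" and le: "\<And>i. i < l \<Longrightarrow> - x i \<le> u i"
    have psd: "psd_mat l (real_diag l (\<lambda>i. - u i))" "psd_mat l (real_diag l (\<lambda>i. x i + u i))"
      using u le by (auto simp: P_def intro!: psd_real_diag) (smt (verit) le)
    \<comment> \<open>Monotonicity of the anti-norm: the increment \<open>x i + u i\<close> is
      nonnegative, so superadditivity adds a nonnegative amount.\<close>
    have "real_diag l x = real_diag l (\<lambda>i. - u i) + real_diag l (\<lambda>i. x i + u i)"
      by (rule eq_matI) (auto simp: real_diag_def mat_diag_def)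
    then have "N (real_diag l (\<lambda>i. - u i)) \<le> N (real_diag l x)"
      using symmetric_antinormD(4)[OF N psd] symmetric_antinormD(1)[OF N psd(2)] by simp
    moreover have "- x i \<le> 0" if "i < l" for i
      using u le[OF that] that by (force simp: P_def)
    ultimately show "P (\<lambda>i. - x i)" using u by (auto simp: P_def)
  qed (use x w maj in \<open>auto simp: P_def sum_negf\<close>)
  then show ?thesis by (simp add: P_def)
qed

lemma symmetric_norm_eq_diag:
  assumes N: "symmetric_norm l N" and A: "hermitian_mat l A"
  shows "N A = N (real_diag l (\<lambda>i. eigs A ! i))"
proof -
  obtain U where U: "unitary_mat l U" and AU: "A = U * real_diag l (\<lambda>i. eigs A ! i) * mat_adjoint U"
    by (rule hermitian_spectral_eigs[OF A])
  show ?thesis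
    by (subst AU) (intro symmetric_normD(3)[OF N] U unitary_mat_adjoint real_diag_carrier)
qed

lemma symmetric_antinorm_eq_diag:
  assumes N: "symmetric_antinorm l N" and A: "psd_mat l A"
  shows "N A = N (real_diag l (\<lambda>i. rev (eigs A) ! i))"
proof -
  have h: "hermitian_mat l A" using A by (simp add: psd_mat_def)
  obtain U where U: "unitary_mat l U" and AU: "A = U * real_diag l (\<lambda>i. rev (eigs A) ! i) * mat_adjoint U"
    by (rule hermitian_spectral_rev_eigs[OF h])
  show ?thesis
    by (subst AU) (intro symmetric_antinormD(3)[OF N] U psd_real_diag psd_rev_eigs_nonneg[OF A])
qed

section \<open>Inversion and traces of functions\<close>

lemma concave_on_neg_inverse: "concave_on {0<..} (\<lambda>x :: real. - inverse x)"
  and mono_on_neg_inverse: "mono_on {0<..} (\<lambda>x :: real. - inverse x)"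
  using convex_on_inverse[of "{0<..} :: real set"] by (auto simp: concave_on_def intro!: mono_onI)

text \<open>Inversion and negation each reverse the order, so together they preserve monotonicity. A
  non-decreasing convex function of the convex function \<open>inverse\<close> is convex, and
  negation makes it concave.\<close>

lemma mono_concave_neg_comp_inverse:
  fixes f :: "real \<Rightarrow> real"
  assumes mono: "mono_on {0<..} f" and conv: "convex_on {0<..} f"
  shows "mono_on {0<..} (\<lambda>x. - f (inverse x))" and "concave_on {0<..} (\<lambda>x. - f (inverse x))"
proof -
  show "mono_on {0<..} (\<lambda>x. - f (inverse x))"
    using mono_onD[OF mono] by (intro mono_onI) auto
  have "convex_on {0<..} (\<lambda>x. f (inverse x))"
  proof (rule convex_onI)
    fix t x y :: real assume t: "0 < t" "t < 1" and xy: "x \<in> {0<..}" "y \<in> {0<..}"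
    have pos: "0 < (1 - t) * x + t * y" "0 < (1 - t) * inverse x + t * inverse y"
      using t xy by (auto intro!: add_pos_pos mult_pos_pos)
    have "inverse ((1 - t) * x + t * y) \<le> (1 - t) * inverse x + t * inverse y"
      using convex_onD[OF convex_on_inverse[of "{0<..} :: real set"], of t x y] t xy by simp
    then have "f (inverse ((1 - t) * x + t * y)) \<le> f ((1 - t) * inverse x + t * inverse y)"
      using pos by (intro mono_onD[OF mono]) auto
    also have "\<dots> \<le> (1 - t) * f (inverse x) + t * f (inverse y)"
      using convex_onD[OF conv, of t "inverse x" "inverse y"] t xy by simp
    finally show "f (inverse ((1 - t) *\<^sub>R x + t *\<^sub>R y)) \<le> (1 - t) * f (inverse x) + t * f (inverse y)"
      by simp
  qed simp
  then show "concave_on {0<..} (\<lambda>x. - f (inverse x))" by (simp add: concave_on_def)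
qed

lemma tr_fun_eq_sum:
  assumes "hermitian_mat l A"
  shows "tr_fun f A = (\<Sum>i<l. f (eigs A ! i))" "tr_fun f A = (\<Sum>i<l. f (rev (eigs A) ! i))"
proof -
  show "tr_fun f A = (\<Sum>i<l. f (eigs A ! i))"
    using length_eigs[OF assms] by (simp add: tr_fun_def sum_list_sum_nth lessThan_atLeast0)
  have "tr_fun f A = sum_list (map f (rev (eigs A)))"
    unfolding tr_fun_def rev_map[symmetric] by (simp only: sum_list_rev)
  then show "tr_fun f A = (\<Sum>i<l. f (rev (eigs A) ! i))"
    using length_eigs[OF assms] by (simp add: sum_list_sum_nth lessThan_atLeast0)
qed

lemma tr_fun_mat_inv:
  assumes "pd_mat l A"
  shows "tr_fun f (mat_inv l A) = tr_fun (\<lambda>x. f (inverse x)) A"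
proof -
  have "map f (map inverse (rev (eigs A))) = rev (map (\<lambda>x. f (inverse x)) (eigs A))"
    by (simp add: rev_map o_def)
  then show ?thesis
    unfolding tr_fun_def mat_inv_pd(2)[OF assms] by (simp only: sum_list_rev)
qed

section \<open>The implications at a fixed convex combination\<close>

text \<open>\<open>X\<close>, \<open>Y\<close>, \<open>Z\<close> are the values of \<open>F\<close> at a convex combination and at its two end points.\<close>

locale pd_triple =
  fixes l :: nat and X Y Z :: "complex mat" and t :: real
  assumes pd: "pd_mat l X" "pd_mat l Y" "pd_mat l Z" and t: "0 \<le> t" "t \<le> 1"
begin

abbreviation "up A i \<equiv> rev (eigs A) ! i"
abbreviation "inv_eig A i \<equiv> eigs (mat_inv l A) ! i"

text \<open>Condition (a)' at a single convex combination. With the quantifier over \<open>k\<close>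
  inside, the forward implications from (a)' can be proved one triple at a time; the next definition
  does the same for (b)'.\<close>

definition "antinorms_concave \<longleftrightarrow>
  (\<forall>k. 1 \<le> k \<and> k \<le> l \<longrightarrow> t * ky_fan_antinorm k Y + (1 - t) * ky_fan_antinorm k Z \<le> ky_fan_antinorm k X)"

definition "inverse_norms_convex \<longleftrightarrow>
  (\<forall>k. 1 \<le> k \<and> k \<le> l \<longrightarrow> ky_fan_norm k (mat_inv l X) \<le>
    t * ky_fan_norm k (mat_inv l Y) + (1 - t) * ky_fan_norm k (mat_inv l Z))"

lemma herm: "hermitian_mat l X" "hermitian_mat l Y" "hermitian_mat l Z"
  using pd by (auto simp: pd_mat_def)

lemma up_pos: "i < l \<Longrightarrow> 0 < up X i" "i < l \<Longrightarrow> 0 < up Y i" "i < l \<Longrightarrow> 0 < up Z i"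
  using pd pd_rev_eigs_pos by auto

lemma inv_eig_eq:
  assumes "pd_mat l A" "i < l"
  shows "inv_eig A i = inverse (up A i)"
  using assms length_eigs[of l A] by (simp add: mat_inv_pd(2) pd_mat_def)

lemma mix_pos: "0 < a \<Longrightarrow> 0 < b \<Longrightarrow> 0 < t * a + (1 - t) * b"
  using t by (cases "t = 0") (auto intro!: add_pos_nonneg)

lemma supermajorization:
  assumes antinorms_concave and k: "k \<le> l"
  shows "(\<Sum>i<k. t * up Y i + (1 - t) * up Z i) \<le> (\<Sum>i<k. up X i)"
\<comment> \<open>The Ky Fan conditions begin at \<open>k = 1\<close>, while majorization also
  speaks of the empty prefix.\<close>
proof (cases "k = 0")
  case False
  then show ?thesis
    using assms herm unfolding antinorms_concave_def
    by (auto simp: ky_fan_antinorm_eq_sum sum.distrib sum_distrib_left)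
qed simp

lemma submajorization:
  assumes inverse_norms_convex and k: "k \<le> l"
  shows "(\<Sum>i<k. inv_eig X i) \<le> (\<Sum>i<k. t * inv_eig Y i + (1 - t) * inv_eig Z i)"
proof (cases "k = 0")
  case False
  then show ?thesis
    using assms pd unfolding inverse_norms_convex_def
    by (auto simp: ky_fan_norm_eq_sum[OF mat_inv_pd(1)] sum.distrib sum_distrib_left)
qed simp

lemma X_up_mono: "i \<le> j \<Longrightarrow> j < l \<Longrightarrow> up X i \<le> up X j"
  using rev_eigs_mono[of i j X] length_eigs[OF herm(1)] by simp

lemma X_inv_antimono: "i \<le> j \<Longrightarrow> j < l \<Longrightarrow> inv_eig X j \<le> inv_eig X i"
  using eigs_antimono[of i j "mat_inv l X"] length_eigs[OF mat_inv_pd(1)[OF pd(1)]] by simp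

lemma inv_eig_pos: "i < l \<Longrightarrow> 0 < inv_eig X i" "i < l \<Longrightarrow> 0 < inv_eig Y i" "i < l \<Longrightarrow> 0 < inv_eig Z i"
  using inv_eig_eq[OF pd(1)] inv_eig_eq[OF pd(2)] inv_eig_eq[OF pd(3)] up_pos by auto

lemma antinorm_concave:
  assumes ac: antinorms_concave and N: "symmetric_antinorm l N"
  shows "t * N Y + (1 - t) * N Z \<le> N X"
proof -
  have "t * N Y + (1 - t) * N Z = t * N (real_diag l (up Y)) + (1 - t) * N (real_diag l (up Z))"
    using symmetric_antinorm_eq_diag[OF N] pd pd_imp_psd by metis
  also have "\<dots> \<le> N (real_diag l (\<lambda>i. t * up Y i + (1 - t) * up Z i))"
    using t up_pos by (intro symmetric_antinorm_diag_concave[OF N]) (auto intro: less_imp_le)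
  also have "\<dots> \<le> N (real_diag l (up X))"
    by (intro symmetric_antinorm_weak_majorization[OF N] X_up_mono supermajorization[OF ac])
      (auto intro!: less_imp_le mix_pos up_pos)
  also have "\<dots> = N X" using symmetric_antinorm_eq_diag[OF N] pd pd_imp_psd by metis
  finally show ?thesis .
qed

lemma inverse_norm_convex:
  assumes nc: inverse_norms_convex and N: "symmetric_norm l N"
  shows "N (mat_inv l X) \<le> t * N (mat_inv l Y) + (1 - t) * N (mat_inv l Z)"
proof -
  have eq: "N (mat_inv l A) = N (real_diag l (inv_eig A))" if "pd_mat l A" for A
    by (rule symmetric_norm_eq_diag[OF N mat_inv_pd(1)[OF that]])
  have "N (mat_inv l X) = N (real_diag l (inv_eig X))" by (rule eq[OF pd(1)])
  also have "\<dots> \<le> N (real_diag l (\<lambda>i. t * inv_eig Y i + (1 - t) * inv_eig Z i))"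
    by (intro symmetric_norm_weak_majorization[OF N] X_inv_antimono submajorization[OF nc])
      (auto intro: less_imp_le inv_eig_pos)
  also have "\<dots> \<le> t * N (real_diag l (inv_eig Y)) + (1 - t) * N (real_diag l (inv_eig Z))"
    using t by (intro symmetric_norm_diag_convex[OF N]) auto
  finally show ?thesis by (simp add: eq pd)
qed

lemma inverse_mix_le:
  assumes "0 < a" "0 < b"
  shows "inverse (t * a + (1 - t) * b) \<le> t * inverse a + (1 - t) * inverse (b :: real)"
  using convex_onD[OF convex_on_inverse[of "{0<..} :: real set"], of "1 - t" a b] assms t
  by (simp add: algebra_simps)

lemma antinorms_imp_inverse_norms:
  assumes ac: antinorms_concave
  shows inverse_norms_convex
  unfolding inverse_norms_convex_def
proof (intro allI impI)
  fix k assume k: "1 \<le> k \<and> k \<le> l"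
  \<comment> \<open>The concave sum inequality is used at length \<open>k\<close> instead of
    \<open>l\<close>: a prefix of the sequences satisfies the same ordering and partial sum
    conditions.\<close>
  have "(\<Sum>i<k. - inverse (t * up Y i + (1 - t) * up Z i)) \<le> (\<Sum>i<k. - inverse (up X i))"
    using k by (intro weak_supermajorization_sum_concave[OF concave_on_neg_inverse mono_on_neg_inverse]
        X_up_mono supermajorization[OF ac]) (auto intro!: mix_pos up_pos)
  then have "(\<Sum>i<k. inverse (up X i)) \<le> (\<Sum>i<k. inverse (t * up Y i + (1 - t) * up Z i))"
    by (simp add: sum_negf)
  also have "\<dots> \<le> (\<Sum>i<k. t * inverse (up Y i) + (1 - t) * inverse (up Z i))"
    using k up_pos by (intro sum_mono inverse_mix_le) auto
  finally show "ky_fan_norm k (mat_inv l X) \<le>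
      t * ky_fan_norm k (mat_inv l Y) + (1 - t) * ky_fan_norm k (mat_inv l Z)"
    using k pd by (simp add: ky_fan_norm_eq_sum[OF mat_inv_pd(1)] inv_eig_eq sum.distrib sum_distrib_left)
qed

lemma trace_concave:
  assumes ac: antinorms_concave and f: "mono_on {0<..} f" "concave_on {0<..} f"
  shows "t * tr_fun f Y + (1 - t) * tr_fun f Z \<le> tr_fun f X"
proof -
  have "t * tr_fun f Y + (1 - t) * tr_fun f Z = (\<Sum>i<l. t * f (up Y i) + (1 - t) * f (up Z i))"
    unfolding tr_fun_eq_sum(2)[OF herm(2)] tr_fun_eq_sum(2)[OF herm(3)]
    by (simp add: sum.distrib sum_distrib_left)
  also have "\<dots> \<le> (\<Sum>i<l. f (t * up Y i + (1 - t) * up Z i))"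
  proof (rule sum_mono)
    fix i assume "i \<in> {..<l}"
    then have "0 < up Y i" "0 < up Z i" using up_pos by auto
    then show "t * f (up Y i) + (1 - t) * f (up Z i) \<le> f (t * up Y i + (1 - t) * up Z i)"
      using f(2) t unfolding concave_on_iff by simp
  qed
  also have "\<dots> \<le> (\<Sum>i<l. f (up X i))"
    by (intro weak_supermajorization_sum_concave[OF f(2,1)] X_up_mono supermajorization[OF ac])
      (auto intro!: mix_pos up_pos)
  finally show ?thesis by (simp only: tr_fun_eq_sum(2)[OF herm(1)])
qed

lemma inverse_trace_convex:
  assumes nc: inverse_norms_convex and f: "mono_on {0<..} f" "convex_on {0<..} f"
  shows "tr_fun f (mat_inv l X) \<le> t * tr_fun f (mat_inv l Y) + (1 - t) * tr_fun f (mat_inv l Z)"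
proof -
  have "tr_fun f (mat_inv l X) = (\<Sum>i<l. f (inv_eig X i))"
    by (rule tr_fun_eq_sum(1)[OF mat_inv_pd(1)[OF pd(1)]])
  also have "\<dots> \<le> (\<Sum>i<l. f (t * inv_eig Y i + (1 - t) * inv_eig Z i))"
    by (intro weak_submajorization_sum_convex[OF f(2,1)] X_inv_antimono submajorization[OF nc])
      (auto intro!: mix_pos inv_eig_pos)
  also have "\<dots> \<le> (\<Sum>i<l. t * f (inv_eig Y i) + (1 - t) * f (inv_eig Z i))"
  proof (rule sum_mono)
    fix i assume "i \<in> {..<l}"
    then have "0 < inv_eig Y i" "0 < inv_eig Z i" using inv_eig_pos by auto
    then show "f (t * inv_eig Y i + (1 - t) * inv_eig Z i) \<le> t * f (inv_eig Y i) + (1 - t) * f (inv_eig Z i)"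
      using f(2) t unfolding convex_on_def by simp
  qed
  finally show ?thesis
    unfolding tr_fun_eq_sum(1)[OF mat_inv_pd(1)[OF pd(2)]] tr_fun_eq_sum(1)[OF mat_inv_pd(1)[OF pd(3)]]
    by (simp add: sum.distrib sum_distrib_left)
qed

end

theorem theorem4p1:
  fixes n m l :: nat and F :: "complex mat \<Rightarrow> complex mat \<Rightarrow> complex mat"
  assumes F_maps: "\<And>A B. pd_mat n A \<Longrightarrow> pd_mat m B \<Longrightarrow> pd_mat l (F A B)"
  defines "cond_a \<equiv> (\<forall>N. symmetric_antinorm l N \<longrightarrow>
                       jointly_concave n m (\<lambda>A B. N (F A B)))"
      and "cond_a' \<equiv> (\<forall>k. 1 \<le> k \<and> k \<le> l \<longrightarrow>
                       jointly_concave n m (\<lambda>A B. ky_fan_antinorm k (F A B)))"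
      and "cond_b \<equiv> (\<forall>N. symmetric_norm l N \<longrightarrow>
                       jointly_convex n m (\<lambda>A B. N (mat_inv l (F A B))))"
      and "cond_b' \<equiv> (\<forall>k. 1 \<le> k \<and> k \<le> l \<longrightarrow>
                       jointly_convex n m (\<lambda>A B. ky_fan_norm k (mat_inv l (F A B))))"
      and "cond_c \<equiv> (\<forall>f. mono_on {0<..} f \<and> concave_on {0<..} f \<longrightarrow>
                       jointly_concave n m (\<lambda>A B. tr_fun f (F A B)))"
      and "cond_d \<equiv> (\<forall>f. mono_on {0<..} f \<and> convex_on {0<..} f \<longrightarrow>
                       jointly_convex n m (\<lambda>A B. tr_fun f (mat_inv l (F A B))))"
  shows "(cond_a \<longleftrightarrow> cond_a') \<and> (cond_a' \<longrightarrow> cond_b) \<and> (cond_b \<longleftrightarrow> cond_b') \<and>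
         (cond_b' \<longrightarrow> cond_d) \<and> (cond_a \<longrightarrow> cond_c) \<and> (cond_c \<longrightarrow> cond_d)"
proof -
  \<comment> \<open>\<open>S\<close> relates \<open>t\<close> to the three values of
    \<open>F\<close> that one instance of joint concavity or convexity compares. Both notions become
    statements about such triples, and \<open>F\<close> and its arguments disappear from the
    remaining argument.\<close>
  define S where "S X Y Z t \<longleftrightarrow> (\<exists>A1 A2 B1 B2. pd_mat n A1 \<and> pd_mat n A2 \<and>
    pd_mat m B1 \<and> pd_mat m B2 \<and> 0 \<le> t \<and> t \<le> 1 \<and> Y = F A1 B1 \<and> Z = F A2 B2 \<and>
    X = F (complex_of_real t \<cdot>\<^sub>m A1 + complex_of_real (1 - t) \<cdot>\<^sub>m A2)
          (complex_of_real t \<cdot>\<^sub>m B1 + complex_of_real (1 - t) \<cdot>\<^sub>m B2))" for X Y Z t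
  have S_I: "S (F (complex_of_real t \<cdot>\<^sub>m A1 + complex_of_real (1 - t) \<cdot>\<^sub>m A2)
      (complex_of_real t \<cdot>\<^sub>m B1 + complex_of_real (1 - t) \<cdot>\<^sub>m B2)) (F A1 B1) (F A2 B2) t"
    if "pd_mat n A1" "pd_mat n A2" "pd_mat m B1" "pd_mat m B2" "0 \<le> t" "t \<le> 1" for A1 A2 B1 B2 t
    unfolding S_def using that by blast
  have triple: "pd_triple l X Y Z t" if "S X Y Z t" for X Y Z t
  proof -
    obtain A1 A2 B1 B2 where "pd_mat n A1" "pd_mat n A2" "pd_mat m B1" "pd_mat m B2" "0 \<le> t" "t \<le> 1"
      and "Y = F A1 B1" "Z = F A2 B2"
      and "X = F (complex_of_real t \<cdot>\<^sub>m A1 + complex_of_real (1 - t) \<cdot>\<^sub>m A2)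
          (complex_of_real t \<cdot>\<^sub>m B1 + complex_of_real (1 - t) \<cdot>\<^sub>m B2)"
      using \<open>S X Y Z t\<close> unfolding S_def by (elim exE conjE)
    then show ?thesis by (simp only: pd_triple_def F_maps pd_convex_combination simp_thms)
  qed
  have concave_iff: "jointly_concave n m (\<lambda>A B. g (F A B)) \<longleftrightarrow>
      (\<forall>X Y Z t. S X Y Z t \<longrightarrow> t * g Y + (1 - t) * g Z \<le> g X)" for g
  proof
    assume g: "jointly_concave n m (\<lambda>A B. g (F A B))"
    show "\<forall>X Y Z t. S X Y Z t \<longrightarrow> t * g Y + (1 - t) * g Z \<le> g X"
      unfolding S_def
      by (intro allI impI, elim exE conjE, hypsubst) (rule g[unfolded jointly_concave_def, rule_format])
  next
    assume g: "\<forall>X Y Z t. S X Y Z t \<longrightarrow> t * g Y + (1 - t) * g Z \<le> g X"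
    show "jointly_concave n m (\<lambda>A B. g (F A B))"
      unfolding jointly_concave_def by (intro allI impI g[rule_format] S_I)
  qed
  have convex_iff: "jointly_convex n m (\<lambda>A B. g (mat_inv l (F A B))) \<longleftrightarrow>
      (\<forall>X Y Z t. S X Y Z t \<longrightarrow> g (mat_inv l X) \<le> t * g (mat_inv l Y) + (1 - t) * g (mat_inv l Z))" for g
  proof
    assume g: "jointly_convex n m (\<lambda>A B. g (mat_inv l (F A B)))"
    show "\<forall>X Y Z t. S X Y Z t \<longrightarrow> g (mat_inv l X) \<le> t * g (mat_inv l Y) + (1 - t) * g (mat_inv l Z)"
      unfolding S_def
      by (intro allI impI, elim exE conjE, hypsubst) (rule g[unfolded jointly_convex_def, rule_format])
  next
    assume g: "\<forall>X Y Z t. S X Y Z t \<longrightarrow> g (mat_inv l X) \<le> t * g (mat_inv l Y) + (1 - t) * g (mat_inv l Z)"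
    show "jointly_convex n m (\<lambda>A B. g (mat_inv l (F A B)))"
      unfolding jointly_convex_def by (intro allI impI g[rule_format] S_I)
  qed
  have a': "cond_a' \<longleftrightarrow> (\<forall>X Y Z t. S X Y Z t \<longrightarrow> pd_triple.antinorms_concave l X Y Z t)"
    unfolding cond_a'_def concave_iff using pd_triple.antinorms_concave_def[OF triple] by blast
  have b': "cond_b' \<longleftrightarrow> (\<forall>X Y Z t. S X Y Z t \<longrightarrow> pd_triple.inverse_norms_convex l X Y Z t)"
    unfolding cond_b'_def convex_iff using pd_triple.inverse_norms_convex_def[OF triple] by blast
  have a'_a: "cond_a' \<Longrightarrow> cond_a"
    unfolding a' cond_a_def concave_iff using pd_triple.antinorm_concave[OF triple] by blast
  have a_a': "cond_a \<Longrightarrow> cond_a'"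
    unfolding cond_a_def cond_a'_def using symmetric_antinorm_ky_fan by blast
  have a'_b': "cond_a' \<Longrightarrow> cond_b'"
    unfolding a' b' using pd_triple.antinorms_imp_inverse_norms[OF triple] by blast
  have b'_b: "cond_b' \<Longrightarrow> cond_b"
    unfolding b' cond_b_def convex_iff using pd_triple.inverse_norm_convex[OF triple] by blast
  have b_b': "cond_b'" if b: cond_b
    unfolding cond_b'_def convex_iff
  proof (intro allI impI)
    fix k X Y Z t assume k: "1 \<le> k \<and> k \<le> l" and S: "S X Y Z t"
    interpret pd_triple l X Y Z t by (rule triple[OF S])
    \<comment> \<open>Inverses of positive definite matrices have nonnegative eigenvalues, so on
      them the extended norm has the values that (b)' speaks of.\<close>
    have "variational_ky_fan_norm l k (mat_inv l A) = ky_fan_norm k (mat_inv l A)" if "pd_mat l A" for A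
      using k pd_rev_eigs_pos[OF that] less_imp_le
      by (intro variational_ky_fan_norm_eq mat_inv_pd(1) that) (auto simp: inv_eig_eq[OF that])
    moreover have "variational_ky_fan_norm l k (mat_inv l X) \<le>
        t * variational_ky_fan_norm l k (mat_inv l Y) + (1 - t) * variational_ky_fan_norm l k (mat_inv l Z)"
      using b k S symmetric_norm_variational_ky_fan[of k l] unfolding cond_b_def convex_iff by blast
    ultimately show "ky_fan_norm k (mat_inv l X) \<le>
        t * ky_fan_norm k (mat_inv l Y) + (1 - t) * ky_fan_norm k (mat_inv l Z)"
      using pd by simp
  qed
  have b'_d: "cond_b' \<Longrightarrow> cond_d"
    unfolding b' cond_d_def convex_iff using pd_triple.inverse_trace_convex[OF triple] by blast
  have a'_c: "cond_a' \<Longrightarrow> cond_c"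
    unfolding a' cond_c_def concave_iff using pd_triple.trace_concave[OF triple] by blast
  have c_d: "cond_d" if c: cond_c
    unfolding cond_d_def convex_iff
  proof (intro allI impI)
    fix f :: "real \<Rightarrow> real" and X Y Z t assume f: "mono_on {0<..} f \<and> convex_on {0<..} f" and S: "S X Y Z t"
    interpret pd_triple l X Y Z t by (rule triple[OF S])
    \<comment> \<open>The eigenvalues of the inverse are the reciprocals, so the trace in (d) is, up
      to sign, a trace of the kind in (c), and concavity of the one is convexity of the
      other.\<close>
    have neg: "tr_fun (\<lambda>x. - f (inverse x)) A = - tr_fun f (mat_inv l A)" if "pd_mat l A" for A
      unfolding tr_fun_mat_inv[OF that] by (simp add: tr_fun_def uminus_sum_list_map o_def)
    have "t * tr_fun (\<lambda>x. - f (inverse x)) Y + (1 - t) * tr_fun (\<lambda>x. - f (inverse x)) Z \<le>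
        tr_fun (\<lambda>x. - f (inverse x)) X"
      using c f S mono_concave_neg_comp_inverse[of f] unfolding cond_c_def concave_iff by blast
    then show "tr_fun f (mat_inv l X) \<le> t * tr_fun f (mat_inv l Y) + (1 - t) * tr_fun f (mat_inv l Z)"
      by (simp add: neg pd)
  qed
  show ?thesis using a'_a a_a' a'_b' b'_b b_b' b'_d a'_c c_d by blast
qed

end
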